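(* Suppose that $U$ is a unitary operator, $A$ is an invertible operator, and $\{n_k\}_k$ is a sequence such that $U^{n_k}\to A$ as $k\to\infty$ in the weak operator topology. Let $T$ be a power bounded operator such that $T\sim U$. Set $M=\sup_{n\ge 0}\|T^n\|$. Then $T\approx U$ and $\sup_{n\le 0}\|T^n\|\le\|A^{-1}\|M^2$.
   Context: All Hilbert spaces are complex and separable; operators are linear and bounded; invertible means having a bounded inverse. $U$ and $A$ act on the same Hilbert space. $T$ is power bounded if $\sup_{n\ge 0}\|T^n\|<\infty$. For operators $T$ on $\mathcal H$ and $R$ on $\mathcal K$: $T\approx R$ (similar) means there is a bounded linear $X:\mathcal H\to\mathcal K$ with bounded inverse and $XT=RX$; $T\prec R$ means there is a bounded linear $X:\mathcal H\to\mathcal K$ with $\ker X=\{0\}$, dense range, and $XT=RX$; $T\sim R$ (quasisimilar) means $T\prec R$ and $R\prec T$. For $n<0$, $T^n$ denotes $(T^{-1})^{|n|}$.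
   Formalization: The sequence n_k (of integers) is additionally required to take infinitely many values; without this the claim fails, e.g. for n_k = 0, A = I, U the bilateral shift and T a contraction quasisimilar but not similar to U. *)

theory Defs
  imports "HOL-Analysis.Analysis"
begin

text \<open>
  The distribution has no complex Hilbert spaces. The class below extends the real inner product
  spaces of HOL-Analysis by a complex structure, so that the norm, the topology and
  \<^const>\<open>onorm\<close> are those of the library. The complex inner product \<open>cinner\<close> is linear in its
  first argument, and its real part is the library's real inner product.
\<close>

class separable_chilbert_space = real_inner + complete_space +
  fixes scaleC :: "complex \<Rightarrow> 'a \<Rightarrow> 'a"
    and cinner :: "'a \<Rightarrow> 'a \<Rightarrow> complex"
  assumes scaleC_add_right: "scaleC c (x + y) = scaleC c x + scaleC c y"
    and scaleC_add_left: "scaleC (c + d) x = scaleC c x + scaleC d x"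
    and scaleC_scaleC: "scaleC c (scaleC d x) = scaleC (c * d) x"
    and scaleC_of_real: "scaleC (complex_of_real r) x = r *\<^sub>R x"
    and cinner_commute: "cinner x y = cnj (cinner y x)"
    and cinner_add_left: "cinner (x + y) z = cinner x z + cinner y z"
    and cinner_scaleC_left: "cinner (scaleC c x) y = c * cinner x y"
    and Re_cinner: "Re (cinner x y) = inner x y"
    and separable: "\<exists>D. countable D \<and> (\<forall>x. \<forall>e>0. \<exists>d\<in>D. dist x d < e)"

definition bounded_clinear ::
    "('a::separable_chilbert_space \<Rightarrow> 'b::separable_chilbert_space) \<Rightarrow> bool" where
  "bounded_clinear f \<longleftrightarrow> bounded_linear f \<and> (\<forall>c x. f (scaleC c x) = scaleC c (f x))"

definition invertible_op ::
    "('a::separable_chilbert_space \<Rightarrow> 'b::separable_chilbert_space) \<Rightarrow> bool" where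
  "invertible_op f \<longleftrightarrow> bounded_clinear f \<and> bij f \<and> bounded_clinear (inv f)"

definition unitary_op :: "('a::separable_chilbert_space \<Rightarrow> 'a) \<Rightarrow> bool" where
  "unitary_op U \<longleftrightarrow>
     bounded_clinear U \<and> surj U \<and> (\<forall>x y. cinner (U x) (U y) = cinner x y)"

definition power_bounded :: "('a::separable_chilbert_space \<Rightarrow> 'a) \<Rightarrow> bool" where
  "power_bounded T \<longleftrightarrow> bounded_clinear T \<and> bdd_above (range (\<lambda>n::nat. onorm (T ^^ n)))"

text \<open>Integer powers; for negative exponents only meaningful if \<open>T\<close> is bijective.\<close>

definition int_funpow :: "('a \<Rightarrow> 'a) \<Rightarrow> int \<Rightarrow> 'a \<Rightarrow> 'a" where
  "int_funpow T n = (if 0 \<le> n then T ^^ nat n else inv T ^^ nat \<bar>n\<bar>)"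

definition wot_tendsto ::
    "(nat \<Rightarrow> 'a::separable_chilbert_space \<Rightarrow> 'a) \<Rightarrow> ('a \<Rightarrow> 'a) \<Rightarrow> bool" where
  "wot_tendsto S A \<longleftrightarrow> (\<forall>x y. (\<lambda>k. cinner (S k x) y) \<longlonglongrightarrow> cinner (A x) y)"

definition similar_op ::
    "('a::separable_chilbert_space \<Rightarrow> 'a) \<Rightarrow> ('b::separable_chilbert_space \<Rightarrow> 'b) \<Rightarrow> bool" where
  "similar_op T R \<longleftrightarrow> (\<exists>X :: 'a \<Rightarrow> 'b. invertible_op X \<and> X \<circ> T = R \<circ> X)"

definition quasiaffine_transform ::
    "('a::separable_chilbert_space \<Rightarrow> 'a) \<Rightarrow> ('b::separable_chilbert_space \<Rightarrow> 'b) \<Rightarrow> bool" where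
  "quasiaffine_transform T R \<longleftrightarrow>
     (\<exists>X :: 'a \<Rightarrow> 'b. bounded_clinear X \<and> {x. X x = 0} = {0} \<and> closure (range X) = UNIV
        \<and> X \<circ> T = R \<circ> X)"

definition quasisimilar ::
    "('a::separable_chilbert_space \<Rightarrow> 'a) \<Rightarrow> ('b::separable_chilbert_space \<Rightarrow> 'b) \<Rightarrow> bool" where
  "quasisimilar T R \<longleftrightarrow> quasiaffine_transform T R \<and> quasiaffine_transform R T"

end

theory Submission
  imports Defs
begin

text \<open>
  Let \<open>Y\<close> be a quasiaffinity with \<open>Y U = T Y\<close>, and let \<open>V\<close> be the inverse of \<open>U\<close>. On the range of \<open>Y\<close>
  the operator \<open>T\<close> is invertible with \<open>T\<^sup>-\<^sup>1 Y h = Y V h\<close>, so everything reduces to bounding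
  \<open>\<parallel>Y V\<^sup>i h\<parallel>\<close> by \<open>\<parallel>Y h\<parallel>\<close>, uniformly in \<open>i\<close>. Assume that the exponents tend to \<open>+\<infinity>\<close>, and put
  \<open>R = A\<^sup>-\<^sup>1\<close>.

  The backward orbit is controlled by the forward one through the weak limit: as \<open>A R = 1\<close>, the
  vector \<open>Y V\<^sup>i h\<close> is the weak limit of \<open>Y V\<^sup>i U\<^bsup>n\<^esup> R h = T\<^bsup>n - i\<^esup> Y R h\<close> along the given exponents
  \<open>n\<close>, whence \<open>\<parallel>Y V\<^sup>i h\<parallel> \<le> M \<parallel>Y R h\<parallel>\<close>. In the other direction, \<open>Y h = T\<^sup>i Y V\<^sup>i h\<close> gives
  \<open>\<parallel>Y h\<parallel> \<le> M \<parallel>Y V\<^sup>i h\<parallel>\<close>. What remains is to pass from \<open>Y R h\<close> to \<open>Y h\<close>, although \<open>R\<close> has no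
  evident bound in the norm \<open>\<parallel>Y h\<parallel>\<close>. For this the norm is averaged: a Banach limit of
  \<open>\<langle>Y V\<^sup>i x, Y V\<^sup>i y\<rangle>\<close> is a bounded form invariant under \<open>U\<close>. It is represented by a positive
  operator commuting with \<open>U\<close>, and the square root \<open>S\<close> of that operator commutes with \<open>U\<close>, hence with
  the weak limit \<open>A\<close> and with \<open>R\<close>. Averaging the two estimates gives \<open>\<parallel>Y h\<parallel> \<le> M \<parallel>S h\<parallel>\<close> and
  \<open>\<parallel>S h\<parallel> \<le> M \<parallel>Y R h\<parallel>\<close>. Therefore
  \<open>\<parallel>S h\<parallel> = \<parallel>R S A h\<parallel> \<le> \<parallel>R\<parallel> \<parallel>S A h\<parallel> \<le> \<parallel>R\<parallel> M \<parallel>Y h\<parallel>,\<close>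
  and, as \<open>V\<close> is an isometry commuting with \<open>S\<close>,
  \<open>\<parallel>Y V\<^sup>i h\<parallel> \<le> M \<parallel>S V\<^sup>i h\<parallel> = M \<parallel>S h\<parallel> \<le> \<parallel>R\<parallel> M\<^sup>2 \<parallel>Y h\<parallel>.\<close>

  The same inequalities give the similarity: \<open>Y h \<mapsto> S h\<close> is bounded in both directions between dense
  subspaces and intertwines \<open>T\<close> with \<open>U\<close>, so it extends to an invertible operator. These steps are
  \<open>Y_V_pow_le\<close>, \<open>invariant_form\<close> and \<open>unitary_implementation\<close>.

  An infinite set of integer exponents is unbounded above or below. In the second case the adjoint
  \<open>A\<^sup>*\<close> is the weak limit of the powers of \<open>U\<close> with the opposite exponents and has an inverse of the
  same norm (\<open>forward_weak_limit\<close>).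

  Only the real inner product enters until the end. Complex linearity of the similarity comes out of
  the construction because scalar multiplication commutes with everything in sight.
\<close>

section \<open>Projections and the Riesz representation\<close>

lemma inner_eq_all_imp_eq:
  fixes x y :: "'a::real_inner"
  assumes "\<And>z. inner x z = inner y z"
  shows "x = y"
proof -
  have "inner (x - y) (x - y) = 0" by (simp add: inner_diff_left assms)
  then show ?thesis by simp
qed

text \<open>
  A minimizing sequence for the distance from \<open>x\<close> is Cauchy by the parallelogram law, and
  the minimality of its limit forces orthogonality.
\<close>

lemma orthogonal_projection_exists:
  fixes L :: "'a::{real_inner,complete_space} set"
  assumes L: "subspace L" "closed L"
  shows "\<exists>p\<in>L. \<forall>z\<in>L. inner (x - p) z = 0"
proof -
  define m where "m = (INF z\<in>L. (norm (x - z))\<^sup>2)"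
  have ne: "L \<noteq> {}" using L(1) subspace_0 by auto
  have bdd: "bdd_below ((\<lambda>z. (norm (x - z))\<^sup>2) ` L)"
    by (rule bdd_belowI2[of _ 0]) simp
  have m_le: "m \<le> (norm (x - z))\<^sup>2" if "z \<in> L" for z
    unfolding m_def using bdd that by (rule cINF_lower)
  have "\<exists>z\<in>L. (norm (x - z))\<^sup>2 < m + 1 / real (Suc k)" for k
    using cINF_less_iff[OF ne bdd, of "m + 1 / real (Suc k)"] unfolding m_def by auto
  then obtain z where zL: "\<And>k. z k \<in> L"
    and z: "\<And>k. (norm (x - z k))\<^sup>2 < m + 1 / real (Suc k)" by metis
  have zz: "(norm (z i - z j))\<^sup>2 \<le> 2 * (1 / real (Suc i)) + 2 * (1 / real (Suc j))" for i j
  proof -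
    have "(1/2) *\<^sub>R (z i + z j) \<in> L"
      using L(1) zL by (simp add: subspace_add subspace_scale)
    from m_le[OF this] have "4 * m \<le> 4 * (norm (x - (1/2) *\<^sub>R (z i + z j)))\<^sup>2" by simp
    \<comment> \<open>the parallelogram law for the sides \<open>x - z i\<close> and \<open>x - z j\<close>\<close>
    also have "\<dots> = 2 * (norm (x - z i))\<^sup>2 + 2 * (norm (x - z j))\<^sup>2 - (norm (z i - z j))\<^sup>2"
      by (simp add: power2_norm_eq_inner inner_diff_left inner_diff_right inner_add_left
          inner_add_right inner_commute algebra_simps)
    finally show ?thesis using z[of i] z[of j] by linarith
  qed
  have "Cauchy z"
  proof (rule metric_CauchyI)
    fix e :: real assume "e > 0"
    then obtain N where N: "1 / real (Suc N) < e\<^sup>2 / 4"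
      using nat_approx_posE[of "e\<^sup>2 / 4"] by auto
    have "dist (z i) (z j) < e" if "i \<ge> N" "j \<ge> N" for i j
    proof -
      have "1 / real (Suc i) \<le> 1 / real (Suc N)" "1 / real (Suc j) \<le> 1 / real (Suc N)"
        using that by (simp_all add: frac_le)
      then have "(norm (z i - z j))\<^sup>2 < e\<^sup>2" using zz[of i j] N by linarith
      then show ?thesis using \<open>e > 0\<close> by (simp add: dist_norm power2_less_imp_less)
    qed
    then show "\<exists>N. \<forall>i\<ge>N. \<forall>j\<ge>N. dist (z i) (z j) < e" by blast
  qed
  then obtain p where p: "z \<longlonglongrightarrow> p" using Cauchy_convergent convergent_def by blast
  then have pL: "p \<in> L" using L(2) zL closed_sequentially by blast
  have "(\<lambda>k. m + 1 / real (Suc k)) \<longlonglongrightarrow> m + 0"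
    by (intro tendsto_intros LIMSEQ_Suc lim_1_over_n)
  moreover have "(\<lambda>k. (norm (x - z k))\<^sup>2) \<longlonglongrightarrow> (norm (x - p))\<^sup>2"
    by (intro tendsto_intros p)
  ultimately have xp: "(norm (x - p))\<^sup>2 \<le> m"
    using z by (intro LIMSEQ_le[where Y = "\<lambda>k. m + 1 / real (Suc k)"]) (auto intro: less_imp_le)
  have "inner (x - p) v = 0" if "v \<in> L" for v
  proof -
    \<comment> \<open>a step of length \<open>a / N\<close> along \<open>v\<close> would shorten \<open>x - p\<close> unless \<open>a = 0\<close>; adding \<open>1\<close> keeps
      \<open>N\<close> positive when \<open>v = 0\<close>\<close>
    define a N where "a = inner (x - p) v" and "N = (norm v)\<^sup>2 + 1"
    have N: "N > 0" by (simp add: N_def add_nonneg_pos)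
    have expand: "(norm (x - (p + t *\<^sub>R v)))\<^sup>2
        = (norm (x - p))\<^sup>2 - 2 * t * inner (x - p) v + t\<^sup>2 * (norm v)\<^sup>2" for t
      by (simp only: power2_norm_eq_inner)
        (simp add: inner_diff_left inner_diff_right inner_add_left
          inner_add_right inner_commute power2_eq_square algebra_simps)
    have "p + (a / N) *\<^sub>R v \<in> L" using L(1) pL that by (simp add: subspace_add subspace_scale)
    from m_le[OF this] xp have "(norm (x - p))\<^sup>2 \<le> (norm (x - (p + (a / N) *\<^sub>R v)))\<^sup>2"
      by linarith
    also have "\<dots> = (norm (x - p))\<^sup>2 - 2 * (a / N) * a + (a / N)\<^sup>2 * (N - 1)"
      using expand[of "a / N"] by (simp add: a_def N_def)
    also have "\<dots> = (norm (x - p))\<^sup>2 - a\<^sup>2 / N - (a / N)\<^sup>2"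
      using N by (simp add: power2_eq_square field_simps)
    finally have "a\<^sup>2 / N + (a / N)\<^sup>2 \<le> 0" by simp
    moreover have "a\<^sup>2 / N \<ge> 0" "(a / N)\<^sup>2 \<ge> 0" using N by simp_all
    ultimately have "(a / N)\<^sup>2 = 0" by linarith
    then show ?thesis using N by (simp add: a_def)
  qed
  then show ?thesis using pL by blast
qed

text \<open>
  The representing vector is a multiple of a vector orthogonal to the kernel.
\<close>

lemma riesz_representation:
  fixes f :: "'a::{real_inner,complete_space} \<Rightarrow> real"
  assumes "bounded_linear f"
  shows "\<exists>w. \<forall>x. f x = inner x w"
proof (cases "\<forall>x. f x = 0")
  case True
  then show ?thesis by (intro exI[of _ 0]) simp
next
  case False
  interpret f: bounded_linear f by fact
  obtain u where u: "f u \<noteq> 0" using False by blast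
  define L where "L = {x. f x = 0}"
  have "subspace L"
    by (rule subspaceI) (auto simp: L_def f.zero f.add f.scaleR)
  moreover have "closed L"
    unfolding L_def by (intro closed_Collect_eq linear_continuous_on assms continuous_intros)
  ultimately obtain p where p: "p \<in> L" "\<And>z. z \<in> L \<Longrightarrow> inner (u - p) z = 0"
    using orthogonal_projection_exists[of L u] by blast
  define v where "v = u - p"
  have fv: "f v \<noteq> 0" using u p(1) by (simp add: v_def f.diff L_def)
  then have v: "inner v v \<noteq> 0" using f.zero by auto
  have "f x = inner x ((f v / inner v v) *\<^sub>R v)" for x
  proof -
    have "x - (f x / f v) *\<^sub>R v \<in> L" using fv by (simp add: L_def f.diff f.scaleR)
    from p(2)[OF this] have "inner v x = f x / f v * inner v v"
      by (simp add: v_def inner_diff_right)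
    then show ?thesis using fv v by (simp add: inner_commute field_simps)
  qed
  then show ?thesis by blast
qed

lemma bounded_form_represented:
  fixes b :: "'a::{real_inner,complete_space} \<Rightarrow> 'b::{real_inner,complete_space} \<Rightarrow> real"
  assumes l1: "\<And>y. linear (\<lambda>x. b x y)" and l2: "\<And>x. linear (b x)"
    and bd: "\<And>x y. \<bar>b x y\<bar> \<le> c * norm x * norm y" and c: "0 \<le> c"
  shows "\<exists>D. bounded_linear D \<and> (\<forall>x y. b x y = inner (D x) y)"
proof -
  have "bounded_linear (b x)" for x
    by (rule bounded_linear_intro[of _ "c * norm x"])
      (use l2[of x] bd[of x] in \<open>auto simp: linear_add linear_scale algebra_simps\<close>)
  from riesz_representation[OF this] obtain D where D: "\<And>x y. b x y = inner y (D x)" by metis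
  have "D (x + y) = D x + D y" for x y
    by (rule inner_eq_all_imp_eq)
      (simp add: inner_add_left inner_commute[of "D _"] linear_add[OF l1] flip: D)
  moreover have "D (r *\<^sub>R x) = r *\<^sub>R D x" for r x
    by (rule inner_eq_all_imp_eq)
      (simp add: inner_commute[of "D _"] linear_scale[OF l1] flip: D)
  moreover have "norm (D x) \<le> norm x * c" for x
  proof (cases "D x = 0")
    case True
    then show ?thesis using c by simp
  next
    case False
    have "norm (D x) * norm (D x) \<le> c * norm x * norm (D x)"
      using bd[of x "D x"] D[of x "D x"] by (simp add: power2_norm_eq_inner[symmetric] power2_eq_square)
    then show ?thesis using False by (simp add: mult.commute)
  qed
  ultimately have "bounded_linear D" by (rule bounded_linear_intro)
  then show ?thesis using D by (auto simp: inner_commute)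
qed

section \<open>Square roots of positive operators\<close>

text \<open>
  \<open>nonneg_poly_in E p r\<close> holds if \<open>p = q(E)\<close> and \<open>r = q(1)\<close> for a polynomial \<open>q\<close> with nonnegative
  coefficients and constant term \<open>0\<close>. For a contraction \<open>E\<close>, the number \<open>q(1)\<close> bounds the norm of
  \<open>q(E)\<close>, so convergence of operator polynomials can be read off from convergence of numbers.
\<close>

inductive nonneg_poly_in :: "('a::real_inner \<Rightarrow> 'a) \<Rightarrow> ('a \<Rightarrow> 'a) \<Rightarrow> real \<Rightarrow> bool" for E where
  zero: "nonneg_poly_in E (\<lambda>x. 0) 0"
| var: "nonneg_poly_in E E 1"
| add: "nonneg_poly_in E p r \<Longrightarrow> nonneg_poly_in E q s \<Longrightarrow> nonneg_poly_in E (\<lambda>x. p x + q x) (r + s)"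
| mult: "nonneg_poly_in E p r \<Longrightarrow> nonneg_poly_in E q s \<Longrightarrow> nonneg_poly_in E (\<lambda>x. p (q x)) (r * s)"
| scale: "0 \<le> c \<Longrightarrow> nonneg_poly_in E p r \<Longrightarrow> nonneg_poly_in E (\<lambda>x. c *\<^sub>R p x) (c * r)"

text \<open>
  The Visser iteration \<open>P \<mapsto> (E + P\<^sup>2) / 2\<close>, whose fixed points \<open>P\<close> satisfy \<open>(1 - P)\<^sup>2 = 1 - E\<close>.
\<close>

primrec visser_iterate :: "('a::real_inner \<Rightarrow> 'a) \<Rightarrow> nat \<Rightarrow> 'a \<Rightarrow> 'a" where
  "visser_iterate E 0 = (\<lambda>x. 0)"
| "visser_iterate E (Suc k) =
     (\<lambda>x. (1/2) *\<^sub>R (E x + visser_iterate E k (visser_iterate E k x)))"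

text \<open>
  The same iteration for the number \<open>1\<close> in place of \<open>E\<close>.
\<close>

primrec visser_value :: "nat \<Rightarrow> real" where
  "visser_value 0 = 0"
| "visser_value (Suc k) = (1/2) * (1 + visser_value k * visser_value k)"

context
  fixes E :: "'a::real_inner \<Rightarrow> 'a"
  assumes E: "bounded_linear E" and contr: "\<And>x. norm (E x) \<le> norm x"
begin

lemma nonneg_poly_linear: "nonneg_poly_in E p r \<Longrightarrow> bounded_linear p"
  by (induction rule: nonneg_poly_in.induct)
    (auto intro: E bounded_linear_zero bounded_linear_add bounded_linear_const_scaleR
      bounded_linear_compose)

lemma nonneg_poly_value_nonneg: "nonneg_poly_in E p r \<Longrightarrow> 0 \<le> r"
  by (induction rule: nonneg_poly_in.induct) auto

lemma nonneg_poly_norm_le: "nonneg_poly_in E p r \<Longrightarrow> norm (p x) \<le> r * norm x"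
proof (induction arbitrary: x rule: nonneg_poly_in.induct)
  case (add p r q s)
  have "norm (p x + q x) \<le> norm (p x) + norm (q x)" by (rule norm_triangle_ineq)
  also have "\<dots> \<le> (r + s) * norm x" using add.IH[of x] by (simp add: algebra_simps)
  finally show ?case .
next
  case (mult p r q s)
  have "norm (p (q x)) \<le> r * norm (q x)" by (rule mult.IH)
  also have "\<dots> \<le> r * (s * norm x)"
    using mult nonneg_poly_value_nonneg by (intro mult_left_mono) auto
  finally show ?case by simp
next
  case (scale c p r)
  then show ?case using mult_left_mono[OF scale.IH[of x], of c] by (simp add: mult.assoc)
qed (auto simp: contr)

lemma nonneg_poly_commute:
  assumes "nonneg_poly_in E p r" and F: "linear F" "\<And>x. F (E x) = E (F x)"
  shows "F (p x) = p (F x)"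
  using assms(1)
  by (induction arbitrary: x rule: nonneg_poly_in.induct)
    (simp_all add: F linear_add[OF F(1)] linear_scale[OF F(1)] linear_0[OF F(1)])

lemma nonneg_poly_commute_poly:
  assumes "nonneg_poly_in E p r" "nonneg_poly_in E q s"
  shows "q (p x) = p (q x)"
proof (rule nonneg_poly_commute[OF assms(1)])
  show "linear q" using nonneg_poly_linear[OF assms(2)] by (rule bounded_linear.linear)
  show "q (E x) = E (q x)" for x
    using nonneg_poly_commute[OF assms(2), of E] E by (simp add: bounded_linear.linear)
qed

lemma nonneg_poly_self_adjoint:
  assumes "nonneg_poly_in E p r" and sa: "\<And>x y. inner (E x) y = inner x (E y)"
  shows "inner (p x) y = inner x (p y)"
  using assms(1)
proof (induction arbitrary: x y rule: nonneg_poly_in.induct)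
  case (mult p r q s)
  then show ?case by (simp add: nonneg_poly_commute_poly[OF mult.hyps])
qed (simp_all add: sa inner_add_left inner_add_right)

lemma visser_iterate_poly: "nonneg_poly_in E (visser_iterate E k) (visser_value k)"
proof (induction k)
  case (Suc k)
  then show ?case
    using nonneg_poly_in.scale[OF _ nonneg_poly_in.add[OF nonneg_poly_in.var
        nonneg_poly_in.mult[OF Suc Suc]], of "1/2"] by simp
qed (simp add: nonneg_poly_in.zero)

text \<open>
  Nonnegative coefficients of the differences are what makes the iteration converge in norm:
  the norm of a difference is bounded by the difference of the values, which increase and are at
  most \<open>1\<close>.
\<close>

lemma visser_step_poly:
  "nonneg_poly_in E (\<lambda>x. visser_iterate E (Suc k) x - visser_iterate E k x)
     (visser_value (Suc k) - visser_value k)"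
proof (induction k)
  case 0
  have "nonneg_poly_in E (\<lambda>x. (1/2) *\<^sub>R E x) (1/2 * 1)" by (intro nonneg_poly_in.intros) auto
  then show ?case by simp
next
  case (Suc k)
  let ?P = "visser_iterate E k" and ?Q = "visser_iterate E (Suc k)"
  let ?r = "visser_value k" and ?s = "visser_value (Suc k)"
  have P: "nonneg_poly_in E ?P ?r" and Q: "nonneg_poly_in E ?Q ?s" by (rule visser_iterate_poly)+
  note lin = linear_add[OF bounded_linear.linear] linear_diff[OF bounded_linear.linear]
  \<comment> \<open>a difference of squares: \<open>Q\<^sup>2 - P\<^sup>2 = (Q - P) (Q + P)\<close>, as \<open>P\<close> and \<open>Q\<close> commute\<close>
  have "?Q (?Q x + ?P x) - ?P (?Q x + ?P x) = ?Q (?Q x) - ?P (?P x)" for x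
    using nonneg_poly_commute_poly[OF P Q, of x] nonneg_poly_linear[OF P] nonneg_poly_linear[OF Q]
    by (simp only: lin) simp
  then have eq: "visser_iterate E (Suc (Suc k)) x - ?Q x
      = (1/2) *\<^sub>R (?Q (?Q x + ?P x) - ?P (?Q x + ?P x))" for x
    by (simp only: visser_iterate.simps(2)[of E "Suc k"])
      (simp add: algebra_simps)
  have "nonneg_poly_in E (\<lambda>x. (1/2) *\<^sub>R (?Q (?Q x + ?P x) - ?P (?Q x + ?P x)))
      ((1/2) * ((?s - ?r) * (?s + ?r)))"
    using nonneg_poly_in.mult[OF Suc nonneg_poly_in.add[OF Q P]]
    by (intro nonneg_poly_in.scale) auto
  moreover have "(1/2) * ((?s - ?r) * (?s + ?r)) = visser_value (Suc (Suc k)) - ?s"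
    by (simp only: visser_value.simps(2)[of "Suc k"]) (simp add: algebra_simps)
  ultimately show ?case by (simp only: eq)
qed

lemma visser_value_le_1: "visser_value k \<le> 1"
proof (induction k)
  case (Suc k)
  then show ?case
    using mult_le_one[OF Suc nonneg_poly_value_nonneg[OF visser_iterate_poly] Suc] by simp
qed simp

lemma visser_diff_poly:
  assumes "i \<le> j"
  shows "nonneg_poly_in E (\<lambda>x. visser_iterate E j x - visser_iterate E i x)
           (visser_value j - visser_value i)"
  using assms
proof (induction j rule: dec_induct)
  case base
  then show ?case using nonneg_poly_in.zero by simp
next
  case (step j)
  then show ?case using nonneg_poly_in.add[OF visser_step_poly[of j] step.IH] by simp
qed

end

text \<open>
  The Visser iterates converge to some \<open>Q\<close> with \<open>Q = (E + Q\<^sup>2) / 2\<close>, and \<open>1 - Q\<close> is the root.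
  Being a limit of polynomials in \<open>E\<close>, it is self-adjoint and commutes with whatever commutes with
  \<open>E\<close>.
\<close>

lemma sqrt_of_id_minus_contraction:
  fixes E :: "'a::{real_inner,complete_space} \<Rightarrow> 'a"
  assumes E: "bounded_linear E" and contr: "\<And>x. norm (E x) \<le> norm x"
    and sa: "\<And>x y. inner (E x) y = inner x (E y)"
  obtains S where "bounded_linear S" "\<And>x y. inner (S x) y = inner x (S y)"
    "\<And>x. S (S x) = x - E x"
    "\<And>F x. bounded_linear F \<Longrightarrow> (\<And>y. F (E y) = E (F y)) \<Longrightarrow> F (S x) = S (F x)"
proof -
  let ?P = "visser_iterate E" and ?v = visser_value
  note ctx = E contr
  note poly = visser_iterate_poly[OF ctx] and dpoly = visser_diff_poly[OF ctx]
  have "?v i \<le> ?v j" if "i \<le> j" for i j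
    using nonneg_poly_value_nonneg[OF ctx dpoly[OF that]] by simp
  then have "incseq ?v" by (simp add: incseq_def)
  then have "convergent ?v"
    using visser_value_le_1[OF ctx] by (metis incseq_convergent convergent_def)
  then have "Cauchy ?v" by (rule convergent_Cauchy)
  have diff_le: "norm (?P j x - ?P i x) \<le> \<bar>?v j - ?v i\<bar> * norm x" for i j x
  proof (cases "i \<le> j")
    case True
    show ?thesis
      using nonneg_poly_norm_le[OF ctx dpoly[OF True], of x]
        nonneg_poly_value_nonneg[OF ctx dpoly[OF True]] by simp
  next
    case False
    then have "j \<le> i" by simp
    show ?thesis
      using nonneg_poly_norm_le[OF ctx dpoly[OF \<open>j \<le> i\<close>], of x]
        nonneg_poly_value_nonneg[OF ctx dpoly[OF \<open>j \<le> i\<close>]]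
      by (simp add: norm_minus_commute abs_minus_commute)
  qed
  have "Cauchy (\<lambda>k. ?P k x)" for x
  proof (rule metric_CauchyI)
    fix e :: real assume "e > 0"
    then have "e / (norm x + 1) > 0" by (simp add: add_nonneg_pos)
    from metric_CauchyD[OF \<open>Cauchy ?v\<close> this]
    obtain N where N: "\<And>i j. N \<le> i \<Longrightarrow> N \<le> j \<Longrightarrow> dist (?v i) (?v j) < e / (norm x + 1)" by blast
    have "dist (?P i x) (?P j x) < e" if "N \<le> i" "N \<le> j" for i j
    proof -
      have "dist (?P i x) (?P j x) \<le> dist (?v i) (?v j) * norm x"
        using diff_le[of i x j] by (simp add: dist_norm)
      also have "\<dots> \<le> dist (?v i) (?v j) * (norm x + 1)" by (simp add: mult_left_mono)
      also have "\<dots> < e" using N[OF that] by (simp add: pos_less_divide_eq add_nonneg_pos)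
      finally show ?thesis .
    qed
    then show "\<exists>N. \<forall>i\<ge>N. \<forall>j\<ge>N. dist (?P i x) (?P j x) < e" by blast
  qed
  then have "\<exists>l. (\<lambda>k. ?P k x) \<longlonglongrightarrow> l" for x
    using Cauchy_convergent convergent_def by blast
  then obtain Q where Q: "\<And>x. (\<lambda>k. ?P k x) \<longlonglongrightarrow> Q x" by metis
  have norm_P: "norm (?P k x) \<le> norm x" for k x
  proof -
    have "norm (?P k x) \<le> ?v k * norm x" by (rule nonneg_poly_norm_le[OF ctx poly])
    also have "\<dots> \<le> norm x" by (simp add: mult_left_le_one_le visser_value_le_1[OF ctx]
          nonneg_poly_value_nonneg[OF ctx poly])
    finally show ?thesis .
  qed
  have lin: "linear (?P k)" for k
    using nonneg_poly_linear[OF ctx poly] by (rule bounded_linear.linear)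
  have blQ: "bounded_linear Q"
  proof (rule bounded_linear_intro)
    show "Q (x + y) = Q x + Q y" for x y
      using tendsto_add[OF Q[of x] Q[of y]] Q[of "x + y"]
      by (simp add: linear_add[OF lin] LIMSEQ_unique)
    show "Q (r *\<^sub>R x) = r *\<^sub>R Q x" for r x
      using tendsto_scaleR[OF tendsto_const Q[of x], of r] Q[of "r *\<^sub>R x"]
      by (simp add: linear_scale[OF lin] LIMSEQ_unique)
    show "norm (Q x) \<le> norm x * 1" for x
      using tendsto_norm[OF Q[of x]] norm_P by (auto intro: LIMSEQ_le_const2)
  qed
  have saQ: "inner (Q x) y = inner x (Q y)" for x y
    using tendsto_inner[OF Q[of x] tendsto_const[of y]] tendsto_inner[OF tendsto_const[of x] Q[of y]]
    by (simp add: nonneg_poly_self_adjoint[OF ctx poly sa] LIMSEQ_unique)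
  have comm: "F (Q x) = Q (F x)" if F: "bounded_linear F" "\<And>y. F (E y) = E (F y)" for F x
    using bounded_linear.tendsto[OF F(1) Q[of x]] Q[of "F x"]
    by (simp add: nonneg_poly_commute[OF ctx poly bounded_linear.linear[OF F(1)] F(2)] LIMSEQ_unique)
  have fix_point: "Q x = (1/2) *\<^sub>R (E x + Q (Q x))" for x
  proof -
    have "(\<lambda>k. norm (?P k x - Q x)) \<longlonglongrightarrow> 0"
      using Q[of x] by (simp add: tendsto_norm_zero_iff LIM_zero_iff)
    then have "(\<lambda>k. ?P k (?P k x - Q x)) \<longlonglongrightarrow> 0"
      by (rule Lim_null_comparison[rotated]) (simp add: norm_P)
    from tendsto_add[OF this Q[of "Q x"]] have "(\<lambda>k. ?P k (?P k x)) \<longlonglongrightarrow> Q (Q x)"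
      by (simp add: linear_diff[OF lin])
    then have "(\<lambda>k. ?P (Suc k) x) \<longlonglongrightarrow> (1/2) *\<^sub>R (E x + Q (Q x))"
      unfolding visser_iterate.simps by (intro tendsto_intros)
    then show ?thesis using LIMSEQ_Suc[OF Q[of x]] LIMSEQ_unique by blast
  qed
  show thesis
  proof (rule that[of "\<lambda>x. x - Q x"])
    show "bounded_linear (\<lambda>x. x - Q x)" by (intro bounded_linear_sub bounded_linear_ident blQ)
    show "inner (x - Q x) y = inner x (y - Q y)" for x y
      by (simp add: inner_diff_left inner_diff_right saQ)
    show "x - Q x - Q (x - Q x) = x - E x" for x
    proof -
      have "2 *\<^sub>R Q x = E x + Q (Q x)" using fix_point[of x] by (metis
            scaleR_scaleR scaleR_one times_divide_eq_right mult.right_neutral divide_self_if zero_neq_numeral)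
      then show ?thesis
        by (simp add: linear_diff[OF bounded_linear.linear[OF blQ]] scaleR_2 algebra_simps)
    qed
    show "F (x - Q x) = F x - Q (F x)"
      if "bounded_linear F" "\<And>y. F (E y) = E (F y)" for F x
      by (simp add: linear_diff[OF bounded_linear.linear[OF that(1)]] comm[OF that])
  qed
qed

text \<open>
  If \<open>d\<close> bounds the norm of \<open>D\<close>, then positivity makes \<open>E = 1 - D / d\<close> a contraction, and
  \<open>D = d (1 - E)\<close>.
\<close>

lemma positive_operator_sqrt:
  fixes D :: "'a::{real_inner,complete_space} \<Rightarrow> 'a"
  assumes D: "bounded_linear D" and sa: "\<And>x y. inner (D x) y = inner x (D y)"
    and pos: "\<And>x. 0 \<le> inner (D x) x"
  obtains S where "bounded_linear S" "\<And>x y. inner (S x) y = inner x (S y)"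
    "\<And>x. S (S x) = D x"
    "\<And>F x. bounded_linear F \<Longrightarrow> (\<And>y. F (D y) = D (F y)) \<Longrightarrow> F (S x) = S (F x)"
proof -
  obtain d where d: "d > 0" and normD: "\<And>x. norm (D x) \<le> norm x * d"
    using bounded_linear.pos_bounded[OF D] by blast
  note linD = bounded_linear.linear[OF D]
  have Dq: "(norm (D x))\<^sup>2 \<le> d * inner (D x) x" for x
  proof -
    \<comment> \<open>positivity at the vector \<open>x - D x / d\<close>, in place of the Cauchy-Schwarz inequality for the form\<close>
    have "0 \<le> inner (D (x - (1/d) *\<^sub>R D x)) (x - (1/d) *\<^sub>R D x)" by (rule pos)
    also have "\<dots> = inner (D x) x - 2 * (1/d) * (norm (D x))\<^sup>2 + (1/d)\<^sup>2 * inner (D (D x)) (D x)"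
      using sa[of "D x" x]
      by (simp only: power2_norm_eq_inner)
        (simp add: linear_diff[OF linD] linear_scale[OF linD] inner_diff_left inner_diff_right
          power2_eq_square algebra_simps)
    also have "inner (D (D x)) (D x) \<le> d * (norm (D x))\<^sup>2"
      using norm_cauchy_schwarz[of "D (D x)" "D x"] mult_right_mono[OF normD[of "D x"], of "norm (D x)"]
      by (simp add: power2_eq_square mult_ac)
    finally have "0 \<le> inner (D x) x - 2 * (1/d) * (norm (D x))\<^sup>2 + (1/d)\<^sup>2 * (d * (norm (D x))\<^sup>2)"
      by (simp add: mult_left_mono)
    also have "\<dots> = inner (D x) x - (norm (D x))\<^sup>2 / d"
      using d by (simp add: field_simps power2_eq_square)
    finally show ?thesis using d by (simp add: field_simps)
  qed
  define E where "E = (\<lambda>x. x - (1/d) *\<^sub>R D x)"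
  have E: "bounded_linear E"
    unfolding E_def by (intro bounded_linear_sub bounded_linear_ident bounded_linear_const_scaleR D)
  have "(norm (E x))\<^sup>2 \<le> (norm x)\<^sup>2" for x
  proof -
    have "(norm (E x))\<^sup>2 = (norm x)\<^sup>2 - 2 * (1/d) * inner (D x) x + (1/d)\<^sup>2 * (norm (D x))\<^sup>2"
      unfolding E_def power2_norm_eq_inner
      by (simp add: inner_diff_left inner_diff_right inner_commute[of x "D x"] power2_eq_square algebra_simps)
    also have "\<dots> \<le> (norm x)\<^sup>2 - 2 * (1/d) * inner (D x) x + (1/d)\<^sup>2 * (d * inner (D x) x)"
      using Dq by (simp add: mult_left_mono)
    also have "\<dots> = (norm x)\<^sup>2 - inner (D x) x / d"
      using d by (simp add: field_simps power2_eq_square)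
    also have "\<dots> \<le> (norm x)\<^sup>2" using pos d by simp
    finally show ?thesis .
  qed
  then have contr: "norm (E x) \<le> norm x" for x using power2_le_imp_le norm_ge_zero by blast
  have "inner (E x) y = inner x (E y)" for x y
    by (simp add: E_def inner_diff_left inner_diff_right sa)
  from sqrt_of_id_minus_contraction[OF E contr this] obtain R where
    R: "bounded_linear R" "\<And>x y. inner (R x) y = inner x (R y)" "\<And>x. R (R x) = x - E x"
    and comm: "\<And>F x. bounded_linear F \<Longrightarrow> (\<And>y. F (E y) = E (F y)) \<Longrightarrow> F (R x) = R (F x)"
    by blast
  show thesis
  proof (rule that[of "\<lambda>x. sqrt d *\<^sub>R R x"])
    show "bounded_linear (\<lambda>x. sqrt d *\<^sub>R R x)" by (intro bounded_linear_const_scaleR R)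
    show "inner (sqrt d *\<^sub>R R x) y = inner x (sqrt d *\<^sub>R R y)" for x y by (simp add: R(2))
    show "sqrt d *\<^sub>R R (sqrt d *\<^sub>R R x) = D x" for x
      using d by (simp add: linear_scale[OF bounded_linear.linear[OF R(1)]] R(3) E_def)
    fix F x assume F: "bounded_linear F" "\<And>y. F (D y) = D (F y)"
    note linF = bounded_linear.linear[OF F(1)]
    have "F (E y) = E (F y)" for y
      by (simp add: E_def linear_diff[OF linF] linear_scale[OF linF] F(2))
    then show "F (sqrt d *\<^sub>R R x) = sqrt d *\<^sub>R R (F x)"
      by (simp add: linear_scale[OF linF] comm[OF F(1)])
  qed
qed

section \<open>Dense ranges and extension\<close>

lemma dense_range_limit:
  fixes f :: "'a \<Rightarrow> 'b::first_countable_topology"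
  assumes "closure (range f) = UNIV"
  obtains h where "(\<lambda>n::nat. f (h n)) \<longlonglongrightarrow> x"
proof -
  obtain u where u: "\<And>n::nat. u n \<in> range f" "u \<longlonglongrightarrow> x"
    using assms closure_sequential[of x "range f"] by auto
  then have "\<forall>n. \<exists>h. u n = f h" by blast
  then obtain h where "\<And>n. u n = f (h n)" by metis
  then have "u = (\<lambda>n. f (h n))" by (simp add: fun_eq_iff)
  then show thesis using u(2) that by blast
qed

text \<open>
  A vector orthogonal to the range of \<open>S\<close> lies in the kernel of \<open>S\<close>.
\<close>

lemma self_adjoint_injective_dense_range:
  fixes S :: "'a::{real_inner,complete_space} \<Rightarrow> 'a"
  assumes S: "bounded_linear S" and sa: "\<And>x y. inner (S x) y = inner x (S y)"
    and inj: "\<And>x. S x = 0 \<Longrightarrow> x = 0"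
  shows "closure (range S) = UNIV"
proof -
  let ?L = "closure (range S)"
  have sub: "subspace (range S)"
    using bounded_linear.linear[OF S] by (simp add: linear_subspace_image)
  have "subspace ?L"
  proof (rule subspaceI)
    show "0 \<in> ?L" using sub closure_subset subspace_0 by blast
    show "x + y \<in> ?L" if xy: "x \<in> ?L" "y \<in> ?L" for x y
    proof -
      obtain u v where "\<And>n::nat. u n \<in> range S" "u \<longlonglongrightarrow> x"
        "\<And>n::nat. v n \<in> range S" "v \<longlonglongrightarrow> y" using xy unfolding closure_sequential by blast
      then show ?thesis unfolding closure_sequential
        by (intro exI[of _ "\<lambda>n. u n + v n"] conjI allI subspace_add[OF sub] tendsto_add)
    qed
    show "c *\<^sub>R x \<in> ?L" if x: "x \<in> ?L" for c x
    proof -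
      obtain u where "\<And>n::nat. u n \<in> range S" "u \<longlonglongrightarrow> x"
        using x unfolding closure_sequential by blast
      then show ?thesis unfolding closure_sequential
        by (intro exI[of _ "\<lambda>n. c *\<^sub>R u n"] conjI allI subspace_scale[OF sub]
            tendsto_scaleR[OF tendsto_const])
    qed
  qed
  then have proj: "\<exists>p\<in>?L. \<forall>z\<in>?L. inner (x - p) z = 0" for x
    by (rule orthogonal_projection_exists) simp
  have "x \<in> ?L" for x
  proof -
    obtain p where p: "p \<in> ?L" "\<And>z. z \<in> ?L \<Longrightarrow> inner (x - p) z = 0" using proj by blast
    have "inner (S (x - p)) (S (x - p)) = 0"
      unfolding sa by (rule p(2)[OF subsetD[OF closure_subset rangeI]])
    then have "S (x - p) = 0" by simp
    from inj[OF this] show ?thesis using p(1) by simp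
  qed
  then show ?thesis by blast
qed

text \<open>
  The domination makes \<open>Y h \<mapsto> S h\<close> well defined and Lipschitz on the dense range of \<open>Y\<close>, so it
  extends by uniform continuity.
\<close>

lemma dominated_map_factors:
  fixes Y :: "'a::real_normed_vector \<Rightarrow> 'b::real_normed_vector"
    and S :: "'a \<Rightarrow> 'c::{real_normed_vector,complete_space}"
  assumes Y: "linear Y" and dense: "closure (range Y) = UNIV" and S: "linear S"
    and le: "\<And>h. norm (S h) \<le> b * norm (Y h)" and b: "0 \<le> b"
  obtains W where "bounded_linear W" "\<And>h. W (Y h) = S h"
proof -
  define f where "f y = S (SOME h. Y h = y)" for y
  have dist_le: "norm (S h - S h') \<le> b * norm (Y h - Y h')" for h h'
    using le[of "h - h'"] by (simp add: linear_diff[OF Y] linear_diff[OF S])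
  have fY: "f (Y h) = S h" for h
  proof -
    have "Y (SOME h'. Y h' = Y h) = Y h" by (rule someI) simp
    then show ?thesis using dist_le[of "SOME h'. Y h' = Y h" h] by (simp add: f_def)
  qed
  have "b-lipschitz_on (range Y) f"
    by (rule lipschitz_onI) (auto simp: fY dist_norm dist_le b)
  from uniformly_continuous_on_extension_on_closure[OF lipschitz_on_uniformly_continuous[OF this]]
  obtain W where W: "uniformly_continuous_on (closure (range Y)) W" "\<And>y. y \<in> range Y \<Longrightarrow> f y = W y"
    by metis
  have WY: "W (Y h) = S h" for h using W(2) fY by (metis rangeI)
  have cont: "continuous_on UNIV W" using W(1) dense uniformly_continuous_imp_continuous by auto
  have lim: "(\<lambda>n. W (u n)) \<longlonglongrightarrow> W x" if "u \<longlonglongrightarrow> x" for u :: "nat \<Rightarrow> 'b" and x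
    using continuous_on_tendsto_compose[OF cont that] by simp
  have "bounded_linear W"
  proof (rule bounded_linear_intro)
    fix x y :: 'b and r :: real
    obtain h h' where h: "(\<lambda>n. Y (h n)) \<longlonglongrightarrow> x" and h': "(\<lambda>n. Y (h' n)) \<longlonglongrightarrow> y"
      using dense_range_limit[OF dense, of x] dense_range_limit[OF dense, of y] by metis
    note Sh = lim[OF h, unfolded WY] and Sh' = lim[OF h', unfolded WY]
    have "(\<lambda>n. Y (h n + h' n)) \<longlonglongrightarrow> x + y"
      using tendsto_add[OF h h'] by (simp add: linear_add[OF Y])
    from lim[OF this] show "W (x + y) = W x + W y"
      using tendsto_add[OF Sh Sh'] by (simp add: WY linear_add[OF S] LIMSEQ_unique)
    have "(\<lambda>n. Y (r *\<^sub>R h n)) \<longlonglongrightarrow> r *\<^sub>R x"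
      using tendsto_scaleR[OF tendsto_const h] by (simp add: linear_scale[OF Y])
    from lim[OF this] show "W (r *\<^sub>R x) = r *\<^sub>R W x"
      using tendsto_scaleR[OF tendsto_const Sh, of r] by (simp add: WY linear_scale[OF S] LIMSEQ_unique)
    show "norm (W x) \<le> norm x * b"
      using le by (intro LIMSEQ_le[OF tendsto_norm[OF Sh] tendsto_mult_right[OF tendsto_norm[OF h]]])
        (simp add: mult.commute)
  qed
  then show thesis using WY that by blast
qed

section \<open>Banach limits\<close>

text \<open>
  By the theorem of Tychonoff the sequence lives in a compact product of intervals; a filter finer
  than \<open>sequentially\<close> converges to a cluster point. This replaces the choice of a free ultrafilter.
\<close>

lemma pointwise_cluster_point:
  fixes f :: "nat \<Rightarrow> 'i \<Rightarrow> real"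
  assumes "\<And>n i. \<bar>f n i\<bar> \<le> c i"
  obtains G l where "G \<noteq> bot" "G \<le> sequentially" "\<And>i. ((\<lambda>n. f n i) \<longlongrightarrow> l i) G"
proof -
  let ?K = "PiE UNIV (\<lambda>i. {- c i..c i})"
  have "compactin (product_topology (\<lambda>i. euclidean) UNIV) ?K"
    by (simp add: compactin_PiE)
  then have "compact ?K" by (simp add: euclidean_product_topology)
  moreover have "filtermap f sequentially \<noteq> bot" by (simp add: filtermap_bot_iff)
  moreover have "eventually (\<lambda>x. x \<in> ?K) (filtermap f sequentially)"
  proof -
    have "f n \<in> ?K" for n using assms[of n]
      by (simp add: PiE_UNIV_domain Pi_iff abs_le_iff minus_le_iff)
    then show ?thesis by (simp add: eventually_filtermap)
  qed
  ultimately obtain l where l: "inf (nhds l) (filtermap f sequentially) \<noteq> bot"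
    unfolding compact_filter by blast
  define G where "G = inf (filtercomap f (nhds l)) sequentially"
  have "G \<noteq> bot"
  proof
    assume "G = bot"
    then obtain P Q where PQ: "eventually P (filtercomap f (nhds l))" "eventually Q sequentially"
      "\<And>n. P n \<Longrightarrow> Q n \<Longrightarrow> False"
      unfolding G_def trivial_limit_def eventually_inf by blast
    from PQ(1) obtain R where R: "eventually R (nhds l)" "\<And>n. R (f n) \<Longrightarrow> P n"
      unfolding eventually_filtercomap by blast
    have "eventually (\<lambda>n. \<not> R (f n)) sequentially"
      using PQ(2) by (rule eventually_mono) (use PQ(3) R(2) in blast)
    then have "eventually (\<lambda>x. \<not> R x) (filtermap f sequentially)"
      by (simp add: eventually_filtermap)
    then have "inf (nhds l) (filtermap f sequentially) = bot"
      unfolding trivial_limit_def eventually_inf using R(1) by blast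
    then show False using l by simp
  qed
  moreover have "G \<le> sequentially" by (simp add: G_def)
  moreover have "((\<lambda>n. f n i) \<longlongrightarrow> l i) G" for i
  proof -
    have "filterlim f (nhds l) G"
      unfolding G_def by (rule filterlim_mono[OF filterlim_filtercomap order_refl inf_le1])
    moreover have "continuous_on UNIV (\<lambda>x::'i \<Rightarrow> real. x i)" by simp
    ultimately show ?thesis
      using continuous_on_tendsto_compose[of UNIV "\<lambda>x. x i" f l G] by simp
  qed
  ultimately show thesis using that by blast
qed

definition banach_limit :: "((nat \<Rightarrow> real) \<Rightarrow> real) \<Rightarrow> bool" where
  "banach_limit m \<longleftrightarrow>
     (\<forall>s t. Bseq s \<longrightarrow> Bseq t \<longrightarrow> m (\<lambda>i. s i + t i) = m s + m t)
   \<and> (\<forall>s r. Bseq s \<longrightarrow> m (\<lambda>i. r * s i) = r * m s)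
   \<and> (\<forall>s. Bseq s \<longrightarrow> m (\<lambda>i. s (Suc i)) = m s)
   \<and> (\<forall>s r. Bseq s \<longrightarrow> (\<forall>i. s i \<le> r) \<longrightarrow> m s \<le> r)"

text \<open>
  Cesaro means turn a shift of a bounded sequence into an error of order \<open>1/n\<close>; a simultaneous
  cluster point of the means of all bounded sequences is therefore invariant under the shift.
\<close>

lemma banach_limit_exists: "\<exists>m. banach_limit m"
proof -
  define C where "C s n = (\<Sum>i<Suc n. s i) / real (Suc n)" for s :: "nat \<Rightarrow> real" and n
  have C_le: "C s n \<le> r" if "\<And>i. s i \<le> r" for s n r
    using sum_mono[of "{..<Suc n}" s "\<lambda>_. r"] that
    by (simp add: C_def divide_le_eq mult.commute del: sum.lessThan_Suc)
  have C_abs: "\<bar>C s n\<bar> \<le> K" if "\<And>i. \<bar>s i\<bar> \<le> K" for s n K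
  proof -
    have "C (\<lambda>i. - s i) n = - C s n" by (simp add: C_def sum_negf del: sum.lessThan_Suc)
    then show ?thesis using C_le[of s K n] C_le[of "\<lambda>i. - s i" K n] that
      by (metis abs_le_iff)
  qed
  \<comment> \<open>unbounded sequences get the value \<open>0\<close>, to have a bounded family indexed by all sequences\<close>
  define f where "f n s = (if Bseq s then C s n else 0)" for n s
  have "\<exists>K. \<forall>n. \<bar>f n s\<bar> \<le> K" for s
  proof (cases "Bseq s")
    case True
    then obtain K where "\<And>i. \<bar>s i\<bar> \<le> K" by (auto simp: Bseq_def)
    then have "\<bar>C s n\<bar> \<le> K" for n by (rule C_abs)
    then show ?thesis using True by (auto simp: f_def)
  qed (auto simp: f_def)
  then obtain c where "\<And>n s. \<bar>f n s\<bar> \<le> c s" by metis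
  from pointwise_cluster_point[of f, OF this] obtain G m where
    G: "G \<noteq> bot" "G \<le> sequentially" and lim: "\<And>s. ((\<lambda>n. f n s) \<longlongrightarrow> m s) G" by blast
  have limC: "(C s \<longlongrightarrow> m s) G" if "Bseq s" for s
    using lim[of s] that by (simp add: f_def)
  have Bplus: "Bseq (\<lambda>i. s i + t i)" if st: "Bseq s" "Bseq t" for s t :: "nat \<Rightarrow> real"
  proof -
    obtain K L where "\<And>i. norm (s i) \<le> K" "\<And>i. norm (t i) \<le> L"
      using st by (auto simp: Bseq_def)
    then have "norm (s i + t i) \<le> K + L" for i by (rule norm_triangle_mono)
    then show ?thesis by (rule BseqI')
  qed
  have "banach_limit m"
    unfolding banach_limit_def
  proof (intro conjI allI impI)
    fix s t :: "nat \<Rightarrow> real" and r :: real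
    assume s: "Bseq s"
    show "m (\<lambda>i. s i + t i) = m s + m t" if t: "Bseq t"
    proof -
      have "C (\<lambda>i. s i + t i) = (\<lambda>n. C s n + C t n)"
        by (simp add: C_def fun_eq_iff sum.distrib add_divide_distrib del: sum.lessThan_Suc)
      then show ?thesis
        using limC[OF Bplus[OF s t]] tendsto_add[OF limC[OF s] limC[OF t]] G(1) tendsto_unique
        by metis
    qed
    show "m (\<lambda>i. r * s i) = r * m s"
    proof -
      have "Bseq (\<lambda>i. r * s i)" by (intro Bseq_mult s) simp
      moreover have "C (\<lambda>i. r * s i) = (\<lambda>n. r * C s n)"
        by (simp add: C_def fun_eq_iff sum_distrib_left del: sum.lessThan_Suc)
      ultimately show ?thesis
        using limC tendsto_mult[OF tendsto_const limC[OF s], of r] G(1) tendsto_unique by metis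
    qed
    show "m s \<le> r" if "\<forall>i. s i \<le> r"
    proof (rule tendsto_upperbound[OF limC[OF s] _ G(1)])
      have "C s k \<le> r" for k using that by (intro C_le) simp
      then show "eventually (\<lambda>k. C s k \<le> r) G" by simp
    qed
    show "m (\<lambda>i. s (Suc i)) = m s"
    proof -
      obtain K where K: "K > 0" "\<And>i. \<bar>s i\<bar> \<le> K" using s by (auto simp: Bseq_def)
      have "C (\<lambda>i. s (Suc i)) n - C s n = (s (Suc n) - s 0) / real (Suc n)" for n
      proof -
        have "(\<Sum>i<Suc n. s (Suc i)) - (\<Sum>i<Suc n. s i) = s (Suc n) - s 0"
          by (subst sum_subtractf[symmetric]) (rule sum_lessThan_telescope)
        then show ?thesis unfolding C_def by (simp only: diff_divide_distrib[symmetric])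
      qed
      then have bd: "norm (C (\<lambda>i. s (Suc i)) n - C s n) \<le> 2 * K * (1 / real (Suc n))" for n
        using K(2)[of "Suc n"] K(2)[of 0] by (simp add: divide_right_mono)
      have "(\<lambda>n. 2 * K * (1 / real (Suc n))) \<longlonglongrightarrow> 0"
        using tendsto_mult[OF tendsto_const LIMSEQ_Suc[OF lim_1_over_n]] by fastforce
      then have "(\<lambda>n. C (\<lambda>i. s (Suc i)) n - C s n) \<longlonglongrightarrow> 0"
        by (rule Lim_null_comparison[OF always_eventually[OF allI[OF bd]]])
      then have "((\<lambda>n. C (\<lambda>i. s (Suc i)) n - C s n) \<longlongrightarrow> 0) G"
        using G(2) tendsto_mono by blast
      moreover have "Bseq (\<lambda>i. s (Suc i))" using s by (simp add: Bseq_Suc_iff)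
      from tendsto_diff[OF limC[OF this] limC[OF s]]
      have "((\<lambda>n. C (\<lambda>i. s (Suc i)) n - C s n) \<longlongrightarrow> m (\<lambda>i. s (Suc i)) - m s) G" .
      ultimately show ?thesis using tendsto_unique[OF G(1)] by fastforce
    qed
  qed
  then show ?thesis by blast
qed

section \<open>Intertwining a unitary with a power bounded operator\<close>

text \<open>
  Bounded operators are weakly continuous, because \<open>x \<mapsto> \<langle>B x, z\<rangle>\<close> is an inner product with a
  fixed vector.
\<close>

lemma weak_limit_bounded_linear:
  fixes B :: "'a::{real_inner,complete_space} \<Rightarrow> 'b::{real_inner,complete_space}"
  assumes B: "bounded_linear B" and x: "\<And>y. ((\<lambda>k. inner (x k) y) \<longlongrightarrow> inner l y) F"
  shows "((\<lambda>k. inner (B (x k)) z) \<longlongrightarrow> inner (B l) z) F"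
proof -
  have "bounded_linear (\<lambda>x. inner (B x) z)"
    using bounded_linear_compose[OF bounded_linear_inner_left B] by simp
  from riesz_representation[OF this] obtain w where "\<And>x. inner (B x) z = inner x w" by blast
  then show ?thesis using x by simp
qed

lemma weak_limit_norm_le:
  fixes l :: "'a::real_inner"
  assumes lim: "\<And>y. (\<lambda>k::nat. inner (x k) y) \<longlonglongrightarrow> inner l y"
    and le: "eventually (\<lambda>k. norm (x k) \<le> c) sequentially"
  shows "norm l \<le> c"
proof -
  have "inner l l \<le> c * norm l"
  proof (rule tendsto_upperbound[OF lim])
    show "\<forall>\<^sub>F k in sequentially. inner (x k) l \<le> c * norm l"
      using le
    proof (rule eventually_mono)
      fix k assume "norm (x k) \<le> c"
      then have "norm (x k) * norm l \<le> c * norm l" by (simp add: mult_right_mono)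
      then show "inner (x k) l \<le> c * norm l" using norm_cauchy_schwarz[of "x k" l] by linarith
    qed
  qed simp
  then have le: "norm l * norm l \<le> c * norm l"
    by (simp add: power2_norm_eq_inner[symmetric] power2_eq_square)
  have "eventually (\<lambda>k. 0 \<le> c) sequentially"
    using assms(2) by (rule eventually_mono) (use norm_ge_zero order_trans in blast)
  then have "0 \<le> c" by simp
  then show ?thesis using le by (cases "l = 0") auto
qed

text \<open>
  The situation with exponents tending to \<open>+\<infinity>\<close>, freed of the complex structure: \<open>V\<close> is the inverse
  of the unitary \<open>U\<close>, and \<open>R\<close> with bound \<open>c\<close> is the inverse of the weak limit \<open>A\<close>.
\<close>

locale power_bounded_intertwining =
  fixes U V A R :: "'h::{real_inner,complete_space} \<Rightarrow> 'h"
    and T :: "'k::{real_inner,complete_space} \<Rightarrow> 'k"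
    and Y :: "'h \<Rightarrow> 'k" and M c :: real and n :: "nat \<Rightarrow> nat"
  assumes U: "bounded_linear U" and V: "bounded_linear V"
    and UV: "\<And>x. U (V x) = x" and VU: "\<And>x. V (U x) = x"
    and isometry: "\<And>x y. inner (U x) (U y) = inner x y"
    and T: "bounded_linear T" and TM: "\<And>j x. norm ((T ^^ j) x) \<le> M * norm x"
    and Y: "bounded_linear Y" and dense: "closure (range Y) = UNIV"
    and Y_inj: "\<And>x. Y x = 0 \<Longrightarrow> x = 0" and YU: "\<And>x. Y (U x) = T (Y x)"
    and A: "bounded_linear A" and R: "bounded_linear R"
    and AR: "\<And>x. A (R x) = x" and RA: "\<And>x. R (A x) = x"
    and Rc: "\<And>x. norm (R x) \<le> c * norm x" and M0: "0 \<le> M" and c0: "0 \<le> c"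
    and n: "filterlim n at_top sequentially"
    and weak: "\<And>x y. (\<lambda>k. inner ((U ^^ n k) x) y) \<longlonglongrightarrow> inner (A x) y"
begin

lemma adjoint_UV: "inner (U x) y = inner x (V y)"
  using isometry[of x "V y"] by (simp add: UV)

lemma V_isometry: "inner (V x) (V y) = inner x y"
  using isometry[of "V x" "V y"] by (simp add: UV)

lemma V_norm: "norm (V x) = norm x"
  by (simp add: norm_eq_sqrt_inner V_isometry)

lemma norm_V_pow: "norm ((V ^^ i) x) = norm x"
  by (induction i) (simp_all add: V_norm)

lemma Y_U_pow: "Y ((U ^^ i) x) = (T ^^ i) (Y x)"
  by (induction i) (simp_all add: YU)

lemma U_V_pow: "(U ^^ i) ((V ^^ i) x) = x"
proof (induction i)
  case (Suc i)
  have "(U ^^ Suc i) ((V ^^ Suc i) x) = (U ^^ i) (U (V ((V ^^ i) x)))"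
    by (simp only: funpow_Suc_right[of i U] funpow.simps(2)[of i V] comp_apply)
  then show ?case using Suc by (simp add: UV)
qed simp

lemma V_U_pow_le: "i \<le> j \<Longrightarrow> (V ^^ i) ((U ^^ j) x) = (U ^^ (j - i)) x"
proof (induction i arbitrary: j)
  case (Suc i)
  then obtain j' where "j = Suc j'" "i \<le> j'" by (metis Suc_le_D Suc_le_mono)
  then show ?case using Suc.IH[of j'] by (simp add: VU funpow_Suc_right del: funpow.simps(2)
        flip: funpow_swap1)
qed simp

lemma V_pow_linear: "bounded_linear (V ^^ i)"
  by (induction i) (auto simp: id_def comp_def intro: bounded_linear_ident bounded_linear_compose[OF V])

text \<open>
  Since \<open>Y x = T\<^sup>i Y V\<^sup>i x\<close>.
\<close>

lemma Y_V_pow_ge: "norm (Y x) \<le> M * norm (Y ((V ^^ i) x))"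
  using TM[of i "Y ((V ^^ i) x)"] by (simp flip: Y_U_pow add: U_V_pow)

text \<open>
  The vector \<open>Y V\<^sup>i x = Y V\<^sup>i A R x\<close> is the weak limit of \<open>Y V\<^sup>i U\<^bsup>n\<^esup> R x = T\<^bsup>n - i\<^esup> Y R x\<close>. This is
  the step in which the weak limit bounds the backward orbit.
\<close>

lemma Y_V_pow_le: "norm (Y ((V ^^ i) x)) \<le> M * norm (Y (R x))"
proof (rule weak_limit_norm_le)
  have B: "bounded_linear (\<lambda>x. Y ((V ^^ i) x))"
    by (rule bounded_linear_compose[OF Y V_pow_linear])
  show "(\<lambda>k. inner (Y ((V ^^ i) ((U ^^ n k) (R x)))) z) \<longlonglongrightarrow> inner (Y ((V ^^ i) x)) z" for z
    by (rule weak_limit_bounded_linear[OF B]) (use weak[of "R x"] in \<open>simp add: AR\<close>)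
  have "eventually (\<lambda>k. i \<le> n k) sequentially"
    using n by (simp add: filterlim_at_top)
  then show "eventually (\<lambda>k. norm (Y ((V ^^ i) ((U ^^ n k) (R x)))) \<le> M * norm (Y (R x))) sequentially"
    by (rule eventually_mono) (simp add: V_U_pow_le Y_U_pow TM)
qed

text \<open>
  The form is a Banach limit of \<open>\<langle>Y V\<^sup>i x, Y V\<^sup>i y\<rangle>\<close>. Its last property, which passes an adjoint pair
  \<open>F\<close>, \<open>F'\<close> from one side to the other, serves to recover complex linearity.
\<close>

lemma invariant_form:
  obtains b :: "'h \<Rightarrow> 'h \<Rightarrow> real" and K where
    "\<And>y. linear (\<lambda>x. b x y)" "\<And>x. linear (b x)" "\<And>x y. b x y = b y x"
    "\<And>x y. \<bar>b x y\<bar> \<le> K * norm x * norm y" "0 \<le> K"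
    "\<And>x y. b (V x) (V y) = b x y"
    "\<And>x. (norm (Y x))\<^sup>2 \<le> M\<^sup>2 * b x x" "\<And>x. b x x \<le> (M * norm (Y (R x)))\<^sup>2"
    "\<And>F F' x y. (\<And>i. inner (Y ((V ^^ i) (F x))) (Y ((V ^^ i) y))
        = inner (Y ((V ^^ i) x)) (Y ((V ^^ i) (F' y)))) \<Longrightarrow> b (F x) y = b x (F' y)"
proof -
  obtain m where "banach_limit m" using banach_limit_exists by blast
  then have m_add: "\<And>s t. Bseq s \<Longrightarrow> Bseq t \<Longrightarrow> m (\<lambda>i. s i + t i) = m s + m t"
    and m_scale: "\<And>s r. Bseq s \<Longrightarrow> m (\<lambda>i. r * s i) = r * m s"
    and m_shift: "\<And>s. Bseq s \<Longrightarrow> m (\<lambda>i. s (Suc i)) = m s"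
    and m_le: "\<And>s r. Bseq s \<Longrightarrow> (\<And>i. s i \<le> r) \<Longrightarrow> m s \<le> r"
    by (simp_all add: banach_limit_def)
  obtain C where C: "C > 0" "\<And>x. norm (Y x) \<le> norm x * C"
    using bounded_linear.pos_bounded[OF Y] by blast
  define q where "q x y i = inner (Y ((V ^^ i) x)) (Y ((V ^^ i) y))" for x y i
  have q_abs: "\<bar>q x y i\<bar> \<le> C\<^sup>2 * norm x * norm y" for x y i
  proof -
    have "\<bar>q x y i\<bar> \<le> norm (Y ((V ^^ i) x)) * norm (Y ((V ^^ i) y))"
      unfolding q_def by (rule Cauchy_Schwarz_ineq2)
    also have "\<dots> \<le> (norm x * C) * (norm y * C)"
      using C(2)[of "(V ^^ i) x"] C(2)[of "(V ^^ i) y"] by (intro mult_mono) (simp_all add: norm_V_pow C(1) less_imp_le)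
    finally show ?thesis by (simp add: power2_eq_square mult_ac)
  qed
  have Bq: "Bseq (q x y)" for x y 
    by (rule BseqI'[of _ "C\<^sup>2 * norm x * norm y"]) (use q_abs in simp)
  have m_ge: "r \<le> m s" if "Bseq s" "\<And>i. r \<le> s i" for s r
  proof -
    have "m (\<lambda>i. (-1) * s i) \<le> - r"
      using that by (intro m_le Bseq_mult) auto
    then show ?thesis using m_scale[OF that(1), of "-1"] by simp
  qed
  define b where "b x y = m (q x y)" for x y
  note linV = bounded_linear.linear[OF V_pow_linear] and linY = bounded_linear.linear[OF Y]
  note lin = linear_add[OF linV] linear_scale[OF linV] linear_add[OF linY] linear_scale[OF linY]
  have q_sym: "q x y = q y x" for x y by (simp add: q_def fun_eq_iff inner_commute)
  have l2: "linear (b x)" for x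
  proof (rule linearI)
    show "b x (y + z) = b x y + b x z" for y z
    proof -
      have "q x (y + z) = (\<lambda>i. q x y i + q x z i)"
        by (simp add: q_def fun_eq_iff lin inner_add_right)
      then show ?thesis by (simp add: b_def m_add Bq)
    qed
    show "b x (r *\<^sub>R y) = r *\<^sub>R b x y" for r y
    proof -
      have "q x (r *\<^sub>R y) = (\<lambda>i. r * q x y i)" by (simp add: q_def fun_eq_iff lin)
      then show ?thesis by (simp add: b_def m_scale Bq)
    qed
  qed
  have sym: "b x y = b y x" for x y by (simp add: b_def q_sym[of x])
  have l1: "linear (\<lambda>x. b x y)" for y using l2[of y] by (simp add: sym[of _ y])
  have b_abs: "\<bar>b x y\<bar> \<le> C\<^sup>2 * norm x * norm y" for x y
    unfolding b_def abs_le_iff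
    using q_abs[of x y] m_le[OF Bq[of x y], of "C\<^sup>2 * norm x * norm y"]
      m_ge[OF Bq[of x y], of "- (C\<^sup>2 * norm x * norm y)"] by (auto simp: abs_le_iff minus_le_iff)
  have inv: "b (V x) (V y) = b x y" for x y
  proof -
    have "q (V x) (V y) = (\<lambda>i. q x y (Suc i))"
      by (simp add: q_def fun_eq_iff funpow_swap1)
    then show ?thesis by (simp add: b_def m_shift Bq)
  qed
  have q_same: "q x x i = (norm (Y ((V ^^ i) x)))\<^sup>2" for x i
    by (simp add: q_def power2_norm_eq_inner)
  have lower: "(norm (Y x))\<^sup>2 \<le> M\<^sup>2 * b x x" for x
  proof -
    have "(norm (Y x))\<^sup>2 \<le> m (\<lambda>i. M\<^sup>2 * q x x i)"
    proof (rule m_ge)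
      show "Bseq (\<lambda>i. M\<^sup>2 * q x x i)" by (intro Bseq_mult Bq) simp
      show "(norm (Y x))\<^sup>2 \<le> M\<^sup>2 * q x x i" for i
        using power_mono[OF Y_V_pow_ge[of x i], of 2] by (simp add: q_same power_mult_distrib)
    qed
    then show ?thesis by (simp add: b_def m_scale Bq)
  qed
  have upper: "b x x \<le> (M * norm (Y (R x)))\<^sup>2" for x
    unfolding b_def by (rule m_le[OF Bq]) (simp add: q_same power_mono Y_V_pow_le)
  have comm: "b (F x) y = b x (F' y)"
    if "\<And>i. inner (Y ((V ^^ i) (F x))) (Y ((V ^^ i) y))
        = inner (Y ((V ^^ i) x)) (Y ((V ^^ i) (F' y)))" for F F' x y
  proof -
    have "q (F x) y = q x (F' y)" using that by (simp add: q_def fun_eq_iff)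
    then show ?thesis by (simp add: b_def)
  qed
  show thesis 
    by (rule that[of b "C\<^sup>2"], rule l1, rule l2, rule sym, rule b_abs, simp, rule inv,
        rule lower, rule upper, rule comm, assumption)
qed

text \<open>
  The operator \<open>S\<close> commutes with all powers of \<open>U\<close>, and moving it to the other side of the inner
  product lets this pass to the weak limit \<open>A\<close>, then to its inverse \<open>R\<close>.
\<close>

lemma commute_inverse_weak_limit:
  assumes S: "bounded_linear S" and sa: "\<And>x y. inner (S x) y = inner x (S y)"
    and SU: "\<And>x. U (S x) = S (U x)"
  shows "S (R x) = R (S x)"
proof -
  have pow: "(U ^^ i) (S x) = S ((U ^^ i) x)" for i x
    by (induction i) (simp_all add: SU)
  have "A (S x) = S (A x)" for x
  proof (rule inner_eq_all_imp_eq)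
    fix z
    have "(\<lambda>k. inner ((U ^^ n k) (S x)) z) \<longlonglongrightarrow> inner (S (A x)) z"
      using weak[of x "S z"] by (simp add: pow sa)
    then show "inner (A (S x)) z = inner (S (A x)) z"
      using weak[of "S x" z] LIMSEQ_unique by blast
  qed
  then have "R (A (S (R x))) = R (S (A (R x)))" by simp
  then show ?thesis by (simp add: AR RA)
qed

text \<open>
  With \<open>S\<close> the square root of the operator of the invariant form, \<open>W\<close> is the extension of
  \<open>Y h \<mapsto> S h\<close>. The last clause says that \<open>W\<close> intertwines, besides \<open>T\<close> and \<open>U\<close>, every pair \<open>G\<close>, \<open>F\<close>
  already intertwined by \<open>Y\<close> together with its adjoints, provided \<open>F\<close> and its adjoint commute with
  \<open>V\<close>; applied to multiplication by a complex number it gives complex linearity.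
\<close>

theorem unitary_implementation:
  obtains W where "bounded_linear W" "bij W" "bounded_linear (inv W)" "\<And>x. W (T x) = U (W x)"
    "\<And>i h. norm (Y ((V ^^ i) h)) \<le> c * M\<^sup>2 * norm (Y h)"
    "\<And>F F' G G' x. \<lbrakk>bounded_linear F; bounded_linear G;
        \<And>x y. inner (F x) y = inner x (F' y); \<And>x y. inner (G x) y = inner x (G' y);
        \<And>x. F (V x) = V (F x); \<And>x. F' (V x) = V (F' x);
        \<And>x. Y (F x) = G (Y x); \<And>x. Y (F' x) = G' (Y x)\<rbrakk> \<Longrightarrow> W (G x) = F (W x)"
proof -
  obtain b K where l1: "\<And>y. linear (\<lambda>x. b x y)" and l2: "\<And>x. linear (b x)"
    and sym: "\<And>x y. b x y = b y x" and bK: "\<And>x y. \<bar>b x y\<bar> \<le> K * norm x * norm y" "0 \<le> K"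
    and b_inv: "\<And>x y. b (V x) (V y) = b x y"
    and lower: "\<And>x. (norm (Y x))\<^sup>2 \<le> M\<^sup>2 * b x x"
    and upper: "\<And>x. b x x \<le> (M * norm (Y (R x)))\<^sup>2"
    and b_comm: "\<And>F F' x y. (\<And>i. inner (Y ((V ^^ i) (F x))) (Y ((V ^^ i) y))
        = inner (Y ((V ^^ i) x)) (Y ((V ^^ i) (F' y)))) \<Longrightarrow> b (F x) y = b x (F' y)"
    by (rule invariant_form) (rule that, (assumption | blast)+)
  obtain D where D: "bounded_linear D" and bD: "\<And>x y. b x y = inner (D x) y"
    using bounded_form_represented[OF l1 l2 bK] by blast
  have D_sa: "inner (D x) y = inner x (D y)" for x y
    using sym[of x y] by (simp add: bD inner_commute)
  have D_pos: "0 \<le> inner (D x) x" for x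
  proof (cases "x = 0")
    case False
    then have "0 < (norm (Y x))\<^sup>2" using Y_inj by auto
    then have "0 < M\<^sup>2 * b x x" using lower[of x] by linarith
    then show ?thesis by (simp add: bD zero_less_mult_iff)
  qed simp
  \<comment> \<open>if \<open>F'\<close> is adjoint to \<open>F\<close> both for the inner product and for \<open>b\<close>, then \<open>F\<close> commutes with \<open>D\<close>\<close>
  have D_comm: "F (D x) = D (F x)"
    if "\<And>x y. inner (F x) y = inner x (F' y)" "\<And>x y. b (F' x) y = b x (F y)" for F F' x
  proof (rule inner_eq_all_imp_eq)
    fix z
    have "inner (F (D x)) z = b x (F' z)" by (simp add: that(1) bD)
    also have "\<dots> = b (F x) z" using that(2)[of z x] sym by metis
    finally show "inner (F (D x)) z = inner (D (F x)) z" by (simp add: bD)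
  qed
  have UD: "U (D x) = D (U x)" for x
  proof (rule D_comm[where F' = V])
    show "b (V x) y = b x (U y)" for x y using b_inv[of x "U y"] by (simp add: VU)
  qed (rule adjoint_UV)
  obtain S where S: "bounded_linear S" and S_sa: "\<And>x y. inner (S x) y = inner x (S y)"
    and SS: "\<And>x. S (S x) = D x"
    and S_comm: "\<And>F x. bounded_linear F \<Longrightarrow> (\<And>y. F (D y) = D (F y)) \<Longrightarrow> F (S x) = S (F x)"
    using positive_operator_sqrt[OF D D_sa D_pos] by blast
  have bS: "b x x = (norm (S x))\<^sup>2" for x
    by (simp add: bD power2_norm_eq_inner S_sa flip: SS)
  have YS: "norm (Y x) \<le> M * norm (S x)" for x
    using lower[of x] M0 by (intro power2_le_imp_le[of "norm (Y x)"])
      (simp_all add: bS power_mult_distrib)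
  have SYR: "norm (S x) \<le> M * norm (Y (R x))" for x
    using upper[of x] M0 by (intro power2_le_imp_le[of "norm (S x)"]) (simp_all add: bS)
  have US: "U (S x) = S (U x)" for x using UD by (rule S_comm[OF U])
  have SY: "norm (S x) \<le> (c * M) * norm (Y x)" for x
  proof -
    have "norm (S x) = norm (R (S (A x)))" by (simp add: commute_inverse_weak_limit[OF S S_sa US, symmetric] RA)
    also have "\<dots> \<le> c * norm (S (A x))" by (rule Rc)
    also have "\<dots> \<le> c * (M * norm (Y x))"
      using SYR[of "A x"] c0 by (simp add: RA mult_left_mono)
    finally show ?thesis by (simp add: mult.assoc)
  qed
  have S_inj: "x = 0" if "S x = 0" for x
    using YS[of x] that Y_inj by simp
  have S_dense: "closure (range S) = UNIV"
    by (rule self_adjoint_injective_dense_range[OF S S_sa S_inj])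
  have VS: "V (S x) = S (V x)" for x
    using US[of "V x"] VU[of "S (V x)"] by (simp add: UV)
  have bound: "norm (Y ((V ^^ i) h)) \<le> c * M\<^sup>2 * norm (Y h)" for i h
  proof -
    have "S ((V ^^ i) h) = (V ^^ i) (S h)" by (induction i) (simp_all add: VS[symmetric])
    then have "norm (Y ((V ^^ i) h)) \<le> M * norm (S h)"
      using YS[of "(V ^^ i) h"] by (simp add: norm_V_pow)
    also have "\<dots> \<le> M * ((c * M) * norm (Y h))" using SY M0 by (simp add: mult_left_mono)
    finally show ?thesis by (simp add: power2_eq_square mult_ac)
  qed
  note linY = bounded_linear.linear[OF Y] and linS = bounded_linear.linear[OF S]
  obtain W where W: "bounded_linear W" and WY: "\<And>h. W (Y h) = S h"
    using dominated_map_factors[OF linY dense linS SY] c0 M0 by (metis mult_nonneg_nonneg)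
  obtain Z where Z: "bounded_linear Z" and ZS: "\<And>h. Z (S h) = Y h"
    using dominated_map_factors[OF linS S_dense linY YS M0] by metis
  have dense_eqI: "f x = g x" if "bounded_linear f" "bounded_linear g" "\<And>h. f (Y h) = g (Y h)"
    for f g :: "'k \<Rightarrow> 'z::real_normed_vector" and x
  proof -
    obtain h where h: "(\<lambda>i. Y (h i)) \<longlonglongrightarrow> x" using dense_range_limit[OF dense] by blast
    show ?thesis
      using bounded_linear.tendsto[OF that(1) h] bounded_linear.tendsto[OF that(2) h]
      by (simp add: that(3) LIMSEQ_unique)
  qed
  have ZW: "Z (W x) = x" for x
    by (rule dense_eqI[OF bounded_linear_compose[OF Z W] bounded_linear_ident]) (simp add: WY ZS)
  have WZ: "W (Z x) = x" for x
  proof -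
    obtain h where h: "(\<lambda>i. S (h i)) \<longlonglongrightarrow> x" using dense_range_limit[OF S_dense] by blast
    show ?thesis
      using bounded_linear.tendsto[OF bounded_linear_compose[OF W Z] h] h
      by (simp add: WY ZS LIMSEQ_unique)
  qed
  have W_comm: "W (G x) = F (W x)"
    if "bounded_linear F" "bounded_linear G" "\<And>x. F (D x) = D (F x)" "\<And>x. Y (F x) = G (Y x)" for F G x
    by (rule dense_eqI[OF bounded_linear_compose[OF W that(2)] bounded_linear_compose[OF that(1) W]])
      (simp add: WY S_comm[OF that(1,3)] flip: that(4))
  show thesis
  proof (rule that[of W])
    show "bounded_linear W" by fact
    show "bij W" by (rule o_bij[of Z]) (simp_all add: fun_eq_iff ZW WZ)
    have "inv W = Z" using ZW WZ by (intro inv_equality)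
    then show "bounded_linear (inv W)" using Z by simp
    show "W (T x) = U (W x)" for x by (rule W_comm[OF U T UD YU])
    show "norm (Y ((V ^^ i) h)) \<le> c * M\<^sup>2 * norm (Y h)" for i h by (rule bound)
    fix F F' G G' x
    assume F: "bounded_linear F" "bounded_linear G"
      and adj: "\<And>x y. inner (F x) y = inner x (F' y)" "\<And>x y. inner (G x) y = inner x (G' y)"
      and FV: "\<And>x. F (V x) = V (F x)" "\<And>x. F' (V x) = V (F' x)"
      and YF: "\<And>x. Y (F x) = G (Y x)" "\<And>x. Y (F' x) = G' (Y x)"
    have pow: "(V ^^ i) (F x) = F ((V ^^ i) x)" "(V ^^ i) (F' x) = F' ((V ^^ i) x)" for i x
      by (induction i) (simp_all add: FV)
    have "F (D x) = D (F x)" for x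
    proof (rule D_comm[OF adj(1)])
      show "b (F' x) y = b x (F y)" for x y
      proof (rule b_comm)
        fix i
        show "inner (Y ((V ^^ i) (F' x))) (Y ((V ^^ i) y))
            = inner (Y ((V ^^ i) x)) (Y ((V ^^ i) (F y)))"
          unfolding pow YF using adj(2)[of "Y ((V ^^ i) y)" "Y ((V ^^ i) x)"]
          by (metis inner_commute)
      qed
    qed
    then show "W (G x) = F (W x)" by (rule W_comm[OF F _ YF(1)])
  qed
qed

end

section \<open>Complex structure and integer exponents\<close>

text \<open>
  The adjoint represents the form \<open>\<langle>y, B x\<rangle>\<close>.
\<close>

lemma adjoint_exists:
  fixes B :: "'a::{real_inner,complete_space} \<Rightarrow> 'b::{real_inner,complete_space}"
  assumes B: "bounded_linear B" and le: "\<And>x. norm (B x) \<le> c * norm x" and c: "0 \<le> c"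
  obtains B' where "bounded_linear B'" "\<And>x y. inner (B x) y = inner x (B' y)"
    "\<And>y. norm (B' y) \<le> c * norm y"
proof -
  note lin = bounded_linear.linear[OF B]
  have "\<exists>B'. bounded_linear B' \<and> (\<forall>y x. inner y (B x) = inner (B' y) x)"
  proof (rule bounded_form_represented)
    show "linear (\<lambda>y. inner y (B x))" for x
      by (rule linearI) (simp_all add: inner_add_left)
    show "linear (\<lambda>x. inner y (B x))" for y
      by (rule linearI) (simp_all add: inner_add_right linear_add[OF lin] linear_scale[OF lin])
    show "\<bar>inner y (B x)\<bar> \<le> c * norm y * norm x" for y x
      using Cauchy_Schwarz_ineq2[of y "B x"] mult_left_mono[OF le[of x] norm_ge_zero[of y]]
      by (simp add: mult_ac)
  qed (rule c)
  then obtain B' where B': "bounded_linear B'" "\<And>y x. inner y (B x) = inner (B' y) x" by blast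
  have adj: "inner (B x) y = inner x (B' y)" for x y
    using B'(2)[of y x] by (simp add: inner_commute)
  have "norm (B' y) \<le> c * norm y" for y
  proof (cases "B' y = 0")
    case False
    have "norm (B' y) * norm (B' y) = inner (B (B' y)) y"
      by (simp add: adj power2_norm_eq_inner[symmetric] power2_eq_square)
    also have "\<dots> \<le> norm (B (B' y)) * norm y" by (rule norm_cauchy_schwarz)
    also have "\<dots> \<le> (c * norm (B' y)) * norm y" by (intro mult_right_mono le) simp
    finally show ?thesis using False by (simp add: mult_ac)
  qed (simp add: c)
  then show thesis using that B'(1) adj by blast
qed

lemma cinner_scaleC_right:
  fixes x y :: "'a::separable_chilbert_space"
  shows "cinner x (scaleC c y) = cnj c * cinner x y"
  by (simp add: cinner_commute[of x] cinner_scaleC_left)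

lemma inner_scaleC_left:
  fixes x y :: "'a::separable_chilbert_space"
  shows "inner (scaleC c x) y = inner x (scaleC (cnj c) y)"
  by (simp add: cinner_scaleC_left cinner_scaleC_right flip: Re_cinner)

text \<open>
  Multiplication by \<open>c\<close> multiplies the norm by \<open>|c|\<close>, since \<open>\<langle>c x, c x\<rangle> = \<langle>(cnj c) c x, x\<rangle>\<close>.
\<close>

lemma bounded_linear_scaleC: "bounded_linear (scaleC c :: 'a::separable_chilbert_space \<Rightarrow> 'a)"
proof (rule bounded_linear_intro[of _ "cmod c"])
  fix x y :: 'a and r :: real
  show "scaleC c (x + y) = scaleC c x + scaleC c y" by (rule scaleC_add_right)
  show "scaleC c (r *\<^sub>R x) = r *\<^sub>R scaleC c x"
    by (simp add: scaleC_scaleC mult.commute flip: scaleC_of_real)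
  have "(norm (scaleC c x))\<^sup>2 = inner (scaleC (cnj c * c) x) x"
    unfolding power2_norm_eq_inner by (metis inner_commute inner_scaleC_left scaleC_scaleC)
  also have "cnj c * c = complex_of_real ((cmod c)\<^sup>2)"
    by (simp only: complex_norm_square) (rule mult.commute)
  finally have "(norm (scaleC c x))\<^sup>2 = (norm x * cmod c)\<^sup>2"
    by (simp add: scaleC_of_real power_mult_distrib power2_norm_eq_inner mult.commute)
  then show "norm (scaleC c x) \<le> norm x * cmod c"
    by (intro power2_le_imp_le[of "norm (scaleC c x)"]) simp_all
qed

lemma bounded_clinear_compose:
  "bounded_clinear f \<Longrightarrow> bounded_clinear g \<Longrightarrow> bounded_clinear (f \<circ> g)"
  using bounded_linear_compose[of f g] by (simp add: bounded_clinear_def o_def)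

lemma bounded_clinear_inv:
  assumes f: "bounded_clinear f" "bij f" and g: "bounded_linear (inv f)"
  shows "bounded_clinear (inv f)"
proof -
  have "inv f (scaleC c y) = scaleC c (inv f y)" for c y
  proof (rule inv_f_eq)
    show "inj f" using f(2) by (rule bij_is_inj)
    show "f (scaleC c (inv f y)) = scaleC c y"
      using f by (simp add: bounded_clinear_def surj_f_inv_f bij_is_surj)
  qed
  then show ?thesis using g by (simp add: bounded_clinear_def)
qed

lemma unitary_op_inverse:
  fixes U :: "'a::separable_chilbert_space \<Rightarrow> 'a"
  assumes "unitary_op U"
  shows "inner (U x) (U y) = inner x y" "bij U" "bounded_clinear (inv U)"
proof -
  have inner: "inner (U x) (U y) = inner x y" for x y
    using assms by (simp add: unitary_op_def flip: Re_cinner)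
  then show "inner (U x) (U y) = inner x y" .
  have norm: "norm (U x) = norm x" for x by (simp add: norm_eq_sqrt_inner inner)
  have U: "bounded_clinear U" and surj: "surj U" using assms by (auto simp: unitary_op_def)
  then have lin: "linear U" by (simp add: bounded_clinear_def bounded_linear.linear)
  have "inj U" unfolding linear_injective_0[OF lin] using norm by (metis norm_eq_zero)
  then show bij: "bij U" using surj by (simp add: bij_def)
  have UV: "U (inv U x) = x" for x using surj by (simp add: surj_f_inv_f)
  have "bounded_linear (inv U)"
  proof (rule bounded_linear_intro[of _ 1])
    fix x y :: 'a and r :: real
    show "inv U (x + y) = inv U x + inv U y"
      by (rule inv_f_eq[OF \<open>inj U\<close>]) (simp add: linear_add[OF lin] UV)
    show "inv U (r *\<^sub>R x) = r *\<^sub>R inv U x"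
      by (rule inv_f_eq[OF \<open>inj U\<close>]) (simp add: linear_scale[OF lin] UV)
    show "norm (inv U x) \<le> norm x * 1" using norm[of "inv U x"] by (simp add: UV)
  qed
  then show "bounded_clinear (inv U)" by (rule bounded_clinear_inv[OF U bij])
qed

lemma infinite_range_int_unbounded:
  fixes n :: "nat \<Rightarrow> int"
  assumes "infinite (range n)"
  shows "(\<forall>j. \<exists>k\<ge>j. int j \<le> n k) \<or> (\<forall>j. \<exists>k\<ge>j. n k \<le> - int j)"
proof (rule ccontr)
  assume "\<not> ?thesis"
  then obtain a b where ab: "\<And>k. a \<le> k \<Longrightarrow> n k < int a" "\<And>k. b \<le> k \<Longrightarrow> - int b < n k"
    by (meson not_le)
  have "range n \<subseteq> n ` {..a + b} \<union> {- int b..int a}"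
  proof
    fix z assume "z \<in> range n"
    then obtain k where k: "z = n k" by blast
    show "z \<in> n ` {..a + b} \<union> {- int b..int a}"
    proof (cases "k \<le> a + b")
      case False
      then show ?thesis using ab[of k] k by simp
    qed (use k in simp)
  qed
  moreover have "finite (n ` {..a + b} \<union> {- int b..int a})" by simp
  ultimately show False using assms finite_subset by blast
qed

lemma inv_isometry_pow_adjoint:
  fixes U :: "'a::real_inner \<Rightarrow> 'a"
  assumes "bij U" "\<And>x y. inner (U x) (U y) = inner x y"
  shows "inner ((inv U ^^ j) x) y = inner x ((U ^^ j) y)"
proof (induction j arbitrary: y)
  case (Suc j)
  have "inner ((inv U ^^ Suc j) x) y = inner (U (inv U ((inv U ^^ j) x))) (U y)"
    by (simp add: assms(2))
  also have "\<dots> = inner ((inv U ^^ j) x) (U y)"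
    using assms(1) by (simp add: surj_f_inv_f bij_is_surj)
  finally show ?case using Suc[of "U y"] by (simp add: funpow_swap1)
qed simp

text \<open>
  If the exponents are unbounded above, \<open>A' = A\<close> and \<open>R = A\<^sup>-\<^sup>1\<close> along a subsequence. Otherwise
  they are unbounded below, and passing to adjoints turns \<open>U\<^bsup>n\<^esup>\<close> into \<open>U\<^bsup>-n\<^esup>\<close>: the witnesses are the
  adjoints of \<open>A\<close> and of \<open>A\<^sup>-\<^sup>1\<close>, and the latter has the same norm bound as \<open>A\<^sup>-\<^sup>1\<close>.
\<close>

lemma forward_weak_limit:
  fixes U A :: "'h::separable_chilbert_space \<Rightarrow> 'h" and n :: "nat \<Rightarrow> int"
  assumes U: "unitary_op U" and A: "invertible_op A" and n: "infinite (range n)"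
    and lim: "wot_tendsto (\<lambda>k. int_funpow U (n k)) A"
  obtains A' R N where "bounded_linear A'" "bounded_linear R"
    "\<And>x. A' (R x) = x" "\<And>x. R (A' x) = x" "\<And>x. norm (R x) \<le> onorm (inv A) * norm x"
    "filterlim N at_top sequentially"
    "\<And>x y. (\<lambda>k::nat. inner ((U ^^ N k) x) y) \<longlonglongrightarrow> inner (A' x) y"
proof -
  have bl: "bounded_linear A" "bounded_linear (inv A)" and bij: "bij A"
    using A by (auto simp: invertible_op_def bounded_clinear_def)
  note onorm_le = onorm[OF bl(2)]
  have AinvA: "A (inv A x) = x" and invAA: "inv A (A x) = x" for x
    using bij by (simp_all add: surj_f_inv_f inv_f_f bij_is_surj bij_is_inj)
  have lim: "(\<lambda>k. inner (int_funpow U (n k) x) y) \<longlonglongrightarrow> inner (A x) y" for x y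
    using tendsto_Re[OF lim[unfolded wot_tendsto_def, rule_format, of x y]] by (simp add: Re_cinner)
  have sub: "filterlim f at_top sequentially" if "\<And>j. j \<le> f j" for f :: "nat \<Rightarrow> nat"
    using filterlim_at_top_mono[OF filterlim_ident, of f] that by simp
  note Uinv = unitary_op_inverse[OF U]
  consider "\<forall>j. \<exists>k\<ge>j. int j \<le> n k" | "\<forall>j. \<exists>k\<ge>j. n k \<le> - int j"
    using infinite_range_int_unbounded[OF n] by blast
  then show thesis
  proof cases
    case 1
    then obtain f where f: "\<And>j. j \<le> f j" "\<And>j. int j \<le> n (f j)" by metis
    have "int_funpow U (n (f j)) = U ^^ nat (n (f j))" for j
      using f(2)[of j] by (simp add: int_funpow_def)
    then have lim': "(\<lambda>j. inner ((U ^^ nat (n (f j))) x) y) \<longlonglongrightarrow> inner (A x) y" for x y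
      using filterlim_compose[OF lim[of x y] sub[OF f(1)]] by simp
    have "j \<le> nat (n (f j))" for j using f(2)[of j] by simp
    from that[OF bl AinvA invAA onorm_le sub[OF this] lim'] show thesis .
  next
    case 2
    then obtain f where f: "\<And>j. j \<le> f j" "\<And>j. n (f j) \<le> - int j" by metis
    have pow: "int_funpow U (n (f j)) = inv U ^^ nat (- n (f j))" for j
      using f(2)[of j] by (auto simp: int_funpow_def)
    obtain A' where A': "bounded_linear A'" "\<And>x y. inner (A x) y = inner x (A' y)"
      by (rule adjoint_exists[OF bl(1) onorm[OF bl(1)] onorm_pos_le[OF bl(1)]]) (rule that)
    obtain R where R: "bounded_linear R" "\<And>x y. inner (inv A x) y = inner x (R y)"
      "\<And>y. norm (R y) \<le> onorm (inv A) * norm y"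
      by (rule adjoint_exists[OF bl(2) onorm_le onorm_pos_le[OF bl(2)]]) (rule that)
    have "inner z (A' (R x)) = inner z x" "inner z (R (A' x)) = inner z x" for x z
      by (simp_all add: invAA AinvA flip: A'(2) R(2))
    then have eq: "inner (A' (R x)) z = inner x z" "inner (R (A' x)) z = inner x z" for x z
      by (simp_all only: inner_commute[of _ z])
    have A'R: "A' (R x) = x" and RA': "R (A' x) = x" for x
      by (rule inner_eq_all_imp_eq, rule eq)+
    have lim': "(\<lambda>j. inner ((U ^^ nat (- n (f j))) x) y) \<longlonglongrightarrow> inner (A' x) y" for x y
    proof -
      have "(\<lambda>j. inner ((inv U ^^ nat (- n (f j))) y) x) \<longlonglongrightarrow> inner (A y) x"
        using filterlim_compose[OF lim[of y x] sub[OF f(1)]] by (simp add: pow)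
      then show ?thesis
        by (simp add: inv_isometry_pow_adjoint[OF Uinv(2,1)] A'(2) inner_commute[of y])
    qed
    have "j \<le> nat (- n (f j))" for j using f(2)[of j] by simp
    from that[OF A'(1) R(1) A'R RA' R(3) sub[OF this] lim'] show thesis .
  qed
qed

theorem theorem2p5:
  fixes U A :: "'h::separable_chilbert_space \<Rightarrow> 'h"
    and T :: "'k::separable_chilbert_space \<Rightarrow> 'k"
    and n :: "nat \<Rightarrow> int"
    and M :: real
  assumes "unitary_op U"
    and "invertible_op A"
    and "infinite (range n)"
    and "wot_tendsto (\<lambda>k. int_funpow U (n k)) A"
    and "power_bounded T"
    and "quasisimilar T U"
    and "M = (SUP m::nat. onorm (T ^^ m))"
  shows "similar_op T U \<and> invertible_op T
    \<and> bdd_above ((\<lambda>m. onorm (int_funpow T m)) ` {..0::int})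
    \<and> (SUP m\<in>{..0::int}. onorm (int_funpow T m)) \<le> onorm (inv A) * M\<^sup>2"
proof -
  let ?V = "inv U" and ?c = "onorm (inv A)"
  note Uinv = unitary_op_inverse[OF assms(1)]
  have cU: "bounded_clinear U" using assms(1) by (simp add: unitary_op_def)
  have cV: "bounded_clinear ?V" by (rule Uinv(3))
  have cT: "bounded_clinear T" using assms(5) by (simp add: power_bounded_def)
  have c0: "0 \<le> ?c"
    by (rule onorm_pos_le) (use assms(2) in \<open>simp add: invertible_op_def bounded_clinear_def\<close>)
  have T: "bounded_linear T" using cT by (simp add: bounded_clinear_def)
  have Tpow: "bounded_linear (T ^^ j)" for j
    by (induction j) (auto simp: id_def comp_def intro: bounded_linear_ident bounded_linear_compose[OF T])
  have onormT: "onorm (T ^^ j) \<le> M" for j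
    using assms(5,7) cSUP_upper[of j UNIV "\<lambda>m. onorm (T ^^ m)"] by (simp add: power_bounded_def)
  then have TM: "norm ((T ^^ j) x) \<le> M * norm x" for j x
    using onorm[OF Tpow, of j x] mult_right_mono[OF onormT[of j] norm_ge_zero[of x]] by linarith
  have M0: "0 \<le> M" using onormT[of 0] onorm_pos_le[OF Tpow, of 0] by linarith
  obtain Y :: "'h \<Rightarrow> 'k" where cY: "bounded_clinear Y" and ker: "{x. Y x = 0} = {0}"
    and dense: "closure (range Y) = UNIV" and YU_comp: "Y \<circ> U = T \<circ> Y"
    using assms(6) by (auto simp: quasisimilar_def quasiaffine_transform_def)
  obtain A' R N where AR: "bounded_linear A'" "bounded_linear R"
    "\<And>x. A' (R x) = x" "\<And>x. R (A' x) = x" "\<And>x. norm (R x) \<le> ?c * norm x"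
    and N: "filterlim N at_top sequentially"
    and weak: "\<And>x y. (\<lambda>k::nat. inner ((U ^^ N k) x) y) \<longlonglongrightarrow> inner (A' x) y"
    by (rule forward_weak_limit[OF assms(1-4)]) (rule that, assumption+)
  interpret power_bounded_intertwining U ?V A' R T Y M ?c N
  proof (rule power_bounded_intertwining.intro)
    show "U (?V x) = x" "?V (U x) = x" for x
      using Uinv(2) by (simp_all add: surj_f_inv_f inv_f_f bij_is_surj bij_is_inj)
    show "x = 0" if "Y x = 0" for x using ker that by blast
    show "Y (U x) = T (Y x)" for x using YU_comp by (simp add: fun_eq_iff)
  qed (use cU cV cY Uinv(1) in \<open>simp_all add: bounded_clinear_def T TM dense AR M0 c0 N weak\<close>)
  obtain W where W: "bounded_linear W" "bij W" "bounded_linear (inv W)"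
    and WT: "\<And>x. W (T x) = U (W x)"
    and bound: "\<And>i h. norm (Y ((?V ^^ i) h)) \<le> ?c * M\<^sup>2 * norm (Y h)"
    and W_comm: "\<And>F F' G G' x. \<lbrakk>bounded_linear F; bounded_linear G;
        \<And>x y. inner (F x) y = inner x (F' y); \<And>x y. inner (G x) y = inner x (G' y);
        \<And>x. F (?V x) = ?V (F x); \<And>x. F' (?V x) = ?V (F' x);
        \<And>x. Y (F x) = G (Y x); \<And>x. Y (F' x) = G' (Y x)\<rbrakk> \<Longrightarrow> W (G x) = F (W x)"
    by (rule unitary_implementation) (rule that, (assumption | blast)+)
  have "W (scaleC c x) = scaleC c (W x)" for c x
    by (rule W_comm[where F = "scaleC c" and G = "scaleC c" and F' = "scaleC (cnj c)"
          and G' = "scaleC (cnj c)"])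
      (use cV cY in \<open>simp_all add: bounded_linear_scaleC inner_scaleC_left bounded_clinear_def\<close>)
  then have cW: "bounded_clinear W" using W(1) by (simp add: bounded_clinear_def)
  have cWi: "bounded_clinear (inv W)" by (rule bounded_clinear_inv[OF cW W(2,3)])
  have "invertible_op W" using cW cWi W(2) by (simp add: invertible_op_def)
  then have sim: "similar_op T U" using WT by (auto simp: similar_op_def fun_eq_iff)
  have T_eq: "T = inv W \<circ> U \<circ> W"
    by (simp add: fun_eq_iff inv_f_f bij_is_inj[OF W(2)] flip: WT)
  have bijT: "bij T" unfolding T_eq using W(2) Uinv(2) by (intro bij_comp bij_imp_bij_inv)
  have "inv T = inv W \<circ> ?V \<circ> W"
    unfolding T_eq using W(2) Uinv(2) by (simp add: o_inv_distrib bij_comp bij_imp_bij_inv inv_inv_eq o_assoc)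
  then have cTi: "bounded_clinear (inv T)"
    using cW cWi cV by (simp add: bounded_clinear_compose)
  have inv: "invertible_op T" using cT bijT cTi by (simp add: invertible_op_def)
  have Ti: "bounded_linear (inv T)" using cTi by (simp add: bounded_clinear_def)
  have Tipow: "bounded_linear (inv T ^^ j)" for j
    by (induction j) (auto simp: id_def comp_def intro: bounded_linear_ident bounded_linear_compose[OF Ti])
  have "inv T (Y h) = Y (?V h)" for h
    by (rule inv_f_eq[OF bij_is_inj[OF bijT]]) (simp add: UV flip: YU)
  then have TY: "(inv T ^^ j) (Y h) = Y ((?V ^^ j) h)" for j h
    by (induction j) simp_all
  have "norm ((inv T ^^ j) x) \<le> ?c * M\<^sup>2 * norm x" for j x
  proof -
    obtain h where h: "(\<lambda>i. Y (h i)) \<longlonglongrightarrow> x" using dense_range_limit[OF dense] by blast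
    show ?thesis
      using bound by (intro LIMSEQ_le[OF tendsto_norm[OF bounded_linear.tendsto[OF Tipow h]]
            tendsto_mult_left[OF tendsto_norm[OF h]]]) (simp add: TY)
  qed
  then have "onorm (inv T ^^ j) \<le> ?c * M\<^sup>2" for j
    using c0 by (intro onorm_bound) simp_all
  moreover have "int_funpow T m = inv T ^^ nat \<bar>m\<bar>" if "m \<le> 0" for m
    using that by (auto simp: int_funpow_def)
  ultimately have le: "onorm (int_funpow T m) \<le> ?c * M\<^sup>2" if "m \<in> {..0}" for m
    using that by simp
  have "bdd_above ((\<lambda>m. onorm (int_funpow T m)) ` {..0::int})"
    using le by (rule bdd_aboveI2)
  moreover have "(SUP m\<in>{..0::int}. onorm (int_funpow T m)) \<le> ?c * M\<^sup>2"
    using le by (intro cSUP_least) auto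
  ultimately show ?thesis using sim inv by blast
qed

end
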